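(* Let $n\ge 1$, let $f\in C([0,1]\times[0,\infty),[0,\infty))$, let $\alpha\ge 0$, $\beta_i\ge 0$ ($1\le i\le n$), $0<\eta_1<\eta_2<\dots<\eta_n<1$, and suppose $\alpha+\sum_{i=1}^n\beta_i<1$. Let $\theta\in(0,\tfrac12)$ be fixed. Assume that one of the following two hypotheses is satisfied: (i) $f_0=\infty$ and $f^\infty=0$; (ii) $f^0=0$ and $f_\infty=\infty$. Then the boundary value problem $$u''''(t)+f(t,u(t))=0,\quad t\in(0,1),$$ $$u'(0)=u'(1)=u''(0)=0,\qquad u(0)=\alpha\int_0^1u(s)\,ds+\sum_{i=1}^n\beta_iu(\eta_i)$$ has at least one positive solution in $K$.
   Context: $C([0,1],\mathbb{R})$ carries the sup norm $\|u\|=\sup_{t\in[0,1]}|u(t)|$. The limits, understood in $[0,\infty]$, are $$f_0=\lim_{u\to0^+}\Big\{\min_{0\le t\le1}\frac{f(t,u)}{u}\Big\},\qquad f^0=\lim_{u\to0^+}\Big\{\max_{0\le t\le1}\frac{f(t,u)}{u}\Big\},$$ $$f_\infty=\lim_{u\to+\infty}\Big\{\min_{0\le t\le1}\frac{f(t,u)}{u}\Big\},\qquad f^\infty=\lim_{u\to+\infty}\Big\{\max_{0\le t\le1}\frac{f(t,u)}{u}\Big\};$$ a hypothesis such as $f_0=\infty$ means that the limit exists and has the indicated value. $K$ is the cone $$K=\Big\{u\in C([0,1],\mathbb{R}):\ u\ge0,\ \min_{t\in[\theta,1-\theta]}u(t)\ge\theta^3(1-2\theta)\|u\|\Big\}.$$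 A solution is a function $u\in C^4([0,1])$ satisfying the differential equation and the boundary conditions; a positive solution is a solution $u$ with $u(t)>0$ for all $t\in(0,1)$. *)

theory Defs
  imports "HOL-Analysis.Analysis"
begin

text \<open>
  A function on \<open>[0,1]\<close> is a total function \<open>real \<Rightarrow> real\<close>, of which only the values on
  \<open>{0..1}\<close> are ever used.  Minima and maxima of continuous functions over compact intervals
  are written as \<open>INF\<close> and \<open>SUP\<close>; they are attained.
\<close>

definition sup_norm :: "(real \<Rightarrow> real) \<Rightarrow> real" where
  "sup_norm u = (SUP t\<in>{0..1}. \<bar>u t\<bar>)"

definition ratio_min :: "(real \<Rightarrow> real \<Rightarrow> real) \<Rightarrow> real \<Rightarrow> real" where
  "ratio_min f u = (INF t\<in>{0..1}. f t u / u)"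

definition ratio_max :: "(real \<Rightarrow> real \<Rightarrow> real) \<Rightarrow> real \<Rightarrow> real" where
  "ratio_max f u = (SUP t\<in>{0..1}. f t u / u)"

definition cone_K :: "real \<Rightarrow> (real \<Rightarrow> real) set" where
  "cone_K \<theta> = {u. continuous_on {0..1} u \<and> (\<forall>t\<in>{0..1}. 0 \<le> u t) \<and>
     (INF t\<in>{\<theta>..1 - \<theta>}. u t) \<ge> \<theta> ^ 3 * (1 - 2 * \<theta>) * sup_norm u}"

text \<open>
  The \<open>k\<close>-th derivative on \<open>[0,1]\<close>, one-sided at the end points.  It is meaningful only for
  functions that are \<open>k\<close> times differentiable there, which \<open>C4_01\<close> guarantees for \<open>k \<le> 4\<close>.
\<close>

definition deriv01 :: "nat \<Rightarrow> (real \<Rightarrow> real) \<Rightarrow> real \<Rightarrow> real" where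
  "deriv01 k u = ((\<lambda>g t. vector_derivative g (at t within {0..1})) ^^ k) u"

definition C4_01 :: "(real \<Rightarrow> real) \<Rightarrow> bool" where
  "C4_01 u \<longleftrightarrow> (\<forall>k<4. deriv01 k u differentiable_on {0..1}) \<and> continuous_on {0..1} (deriv01 4 u)"

definition bvp_solution ::
  "(real \<Rightarrow> real \<Rightarrow> real) \<Rightarrow> real \<Rightarrow> nat \<Rightarrow> (nat \<Rightarrow> real) \<Rightarrow> (nat \<Rightarrow> real) \<Rightarrow> (real \<Rightarrow> real) \<Rightarrow> bool"
where
  "bvp_solution f \<alpha> n \<beta> \<eta> u \<longleftrightarrow>
     C4_01 u \<and>
     (\<forall>t\<in>{0<..<1}. deriv01 4 u t + f t (u t) = 0) \<and>
     deriv01 1 u 0 = 0 \<and> deriv01 1 u 1 = 0 \<and> deriv01 2 u 0 = 0 \<and>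
     u 0 = \<alpha> * integral {0..1} u + (\<Sum>i=1..n. \<beta> i * u (\<eta> i))"

definition positive_bvp_solution ::
  "(real \<Rightarrow> real \<Rightarrow> real) \<Rightarrow> real \<Rightarrow> nat \<Rightarrow> (nat \<Rightarrow> real) \<Rightarrow> (nat \<Rightarrow> real) \<Rightarrow> (real \<Rightarrow> real) \<Rightarrow> bool"
where
  "positive_bvp_solution f \<alpha> n \<beta> \<eta> u \<longleftrightarrow>
     bvp_solution f \<alpha> n \<beta> \<eta> u \<and> (\<forall>t\<in>{0<..<1}. 0 < u t)"

end

theory Submission
  imports Defs "HOL-Complex_Analysis.Great_Picard"
begin

text \<open>
  Write \<open>h(t) = f(t, u(t))\<close>.  Integrating \<open>u'''' = - h\<close> with the three homogeneous conditions on the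
  derivatives gives \<open>u(t) = u(0) + w(t)\<close>, where
  \<open>6 w(t) = t\<^sup>3 \<integral>\<^sub>0\<^sup>1 (1 - s)\<^sup>2 h(s) ds - \<integral>\<^sub>0\<^sup>t (t - s)\<^sup>3 h(s) ds\<close>, and since the
  nonlocal condition has total weight \<open>\<alpha> + \<Sum>\<beta>\<^sub>i < 1\<close>, it determines the constant \<open>u(0)\<close>.  So the
  problem is \<open>u = T h\<close> with an explicit positive linear operator \<open>T\<close> (called \<open>solve\<close>).  Everything
  quantitative rests on the pointwise inequality \<open>t - s \<le> t (1 - s)\<close>: it shows that \<open>T h\<close> is
  nondecreasing and that \<open>t\<^sup>3 (T h)(1) \<le> (T h)(t) \<le> (T h)(1)\<close> (\<open>solve_cubic\<close>, \<open>solve_le_1\<close>).  This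
  bound is stronger than membership in the cone.

  The nonlinear problem is a fixed point problem in the set of functions lying between
  \<open>\<rho> t\<^sup>3\<close> and \<open>\<rho>\<close>, where \<open>\<rho> = u(1)\<close>.  Instead of a fixed point index, the argument separates the
  radius \<open>\<rho>\<close> from the profile \<open>u / \<rho>\<close>: the profile is replaced by the normalised profile of \<open>T h\<close>,
  and the radius by \<open>\<rho> + \<sigma> ((T h)(1) - \<rho>)\<close>, cut off to an interval \<open>[r, R]\<close>.
  This map sends a bounded set of functions to itself for either sign of
  \<open>\<sigma>\<close>, so Schauder's theorem applies to it, and at a fixed point the cut-off can be active only at
  an end point of \<open>[r, R]\<close>.  There the growth of \<open>f\<close> forbids it: with \<open>\<sigma> = 1\<close> in the sublinear
  case, where \<open>T\<close> pushes functions of radius \<open>r\<close> outwards and those of radius \<open>R\<close> inwards, and with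
  \<open>\<sigma> = -1\<close> in the superlinear case, where the directions are reversed.  Hence the radius equation
  holds, and \<open>u = T h\<close> (\<open>radial_fixed_point\<close>).  Thus cone compression and cone expansion are the
  same argument with opposite signs.

  Schauder's theorem is needed only for maps whose range is uniformly Lipschitz
  (\<open>schauder_equi_Lipschitz\<close>).  The finite-dimensional approximations are Bernstein polynomials,
  with a number of coefficients that is unbounded within the proof; so Brouwer's theorem is
  used for cubes whose dimension is a natural number rather than a type, and is
  obtained from Kuhn's combinatorial lemma (\<open>brouwer_nat_cube\<close>).
\<close>

section \<open>Brouwer and Schauder fixed points\<close>

text \<open>
  Only the first \<open>n\<close> coordinates are controlled, so that a cube of variable dimension lives in the
  fixed type \<open>nat \<Rightarrow> real\<close>.
\<close>
lemma cube_seq_compact: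
  fixes X :: "nat \<Rightarrow> nat \<Rightarrow> real"
  assumes "\<And>k i. i < n \<Longrightarrow> X k i \<in> {0..1}"
  shows "\<exists>l r. strict_mono (r :: nat \<Rightarrow> nat) \<and> (\<forall>i<n. (\<lambda>k. X (r k) i) \<longlonglongrightarrow> l i) \<and> (\<forall>i<n. l i \<in> {0..1})"
proof -
  have "\<forall>d\<subseteq>{..<n}. \<exists>l::nat \<Rightarrow> real. \<exists>r::nat\<Rightarrow>nat. strict_mono r \<and>
      (\<forall>e>0. eventually (\<lambda>k. \<forall>i\<in>d. dist (X (r k) i) (l i) < e) sequentially)"
  proof (rule compact_lemma_general[where proj = "\<lambda>x i. x i" and unproj = "\<lambda>x. x" and f = X])
    show "bounded ((\<lambda>x. x i) ` range X)" if "i \<in> {..<n}" for i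
      using assms that by (intro bounded_subset[OF bounded_closed_interval[of 0 "1::real"]]) auto
  qed auto
  then obtain l r where r: "strict_mono (r :: nat \<Rightarrow> nat)"
    and l: "\<And>e. e > 0 \<Longrightarrow> eventually (\<lambda>k. \<forall>i\<in>{..<n}. dist (X (r k) i) (l i) < e) sequentially"
    by blast
  have lim: "(\<lambda>k. X (r k) i) \<longlonglongrightarrow> l i" if "i < n" for i
    unfolding tendsto_iff
  proof (intro allI impI)
    fix e :: real assume "e > 0"
    from l[OF this] show "\<forall>\<^sub>F k in sequentially. dist (X (r k) i) (l i) < e"
      by (rule eventually_mono) (use that in auto)
  qed
  moreover have "l i \<in> {0..1}" if "i < n" for i
    using that assms by (intro closed_sequentially[OF closed_atLeastAtMost _ lim[OF that]]) auto
  ultimately show ?thesis using r by blast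
qed

text \<open>
  Label a grid point in direction \<open>i\<close> by whether \<open>F\<close> moves it up or down there.  Kuhn's lemma yields,
  for every mesh, a grid cell in which both labels occur in each direction.  As the mesh is refined
  these cells accumulate at a point, and by continuity \<open>F\<close> moves it neither up nor down.
\<close>
lemma brouwer_nat_cube:
  fixes F :: "(nat \<Rightarrow> real) \<Rightarrow> nat \<Rightarrow> real"
  assumes range: "\<And>x i. (\<And>j. j < n \<Longrightarrow> x j \<in> {0..1}) \<Longrightarrow> i < n \<Longrightarrow> F x i \<in> {0..1}"
    and cont: "\<And>X x i. (\<And>k j. j < n \<Longrightarrow> X k j \<in> {0..1}) \<Longrightarrow> (\<And>j. j < n \<Longrightarrow> x j \<in> {0..1}) \<Longrightarrow>
       (\<And>j. j < n \<Longrightarrow> (\<lambda>k. X k j) \<longlonglongrightarrow> x j) \<Longrightarrow> i < n \<Longrightarrow> (\<lambda>k. F (X k) i) \<longlonglongrightarrow> F x i"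
  shows "\<exists>x. (\<forall>i<n. x i \<in> {0..1}) \<and> (\<forall>i<n. F x i = x i)"
proof -
  define P where "P = (\<lambda>x::nat\<Rightarrow>real. \<forall>i<n. x i \<in> {0..1})"
  define F' where "F' = (\<lambda>x i. if i < n then F x i else x i)"
  have "\<forall>x. P x \<longrightarrow> P (F' x)" using range by (auto simp: P_def F'_def)
  moreover have "\<forall>x. P x \<longrightarrow> (\<forall>i. i < n \<longrightarrow> 0 \<le> x i \<and> x i \<le> 1)" by (auto simp: P_def)
  ultimately obtain lab :: "(nat \<Rightarrow> real) \<Rightarrow> nat \<Rightarrow> nat" where lab':
    "\<forall>x i. lab x i \<le> 1" "\<forall>x i. P x \<and> i < n \<and> x i = 0 \<longrightarrow> lab x i = 0"
    "\<forall>x i. P x \<and> i < n \<and> x i = 1 \<longrightarrow> lab x i = 1"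
    "\<forall>x i. P x \<and> i < n \<and> lab x i = 0 \<longrightarrow> x i \<le> F' x i"
    "\<forall>x i. P x \<and> i < n \<and> lab x i = 1 \<longrightarrow> F' x i \<le> x i"
    using kuhn_labelling_lemma'[of P F' "\<lambda>i. i < n"] by blast
  have lab: "\<And>x i. lab x i \<le> 1"
    "\<And>x i. P x \<Longrightarrow> i < n \<Longrightarrow> x i = 0 \<Longrightarrow> lab x i = 0"
    "\<And>x i. P x \<Longrightarrow> i < n \<Longrightarrow> x i = 1 \<Longrightarrow> lab x i = 1"
    "\<And>x i. P x \<Longrightarrow> i < n \<Longrightarrow> lab x i = 0 \<Longrightarrow> x i \<le> F x i"
    "\<And>x i. P x \<Longrightarrow> i < n \<Longrightarrow> lab x i = 1 \<Longrightarrow> F x i \<le> x i"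
    using lab' by (auto simp: F'_def)
  define g where "g = (\<lambda>p (q::nat\<Rightarrow>nat) i. real (q i) / real (Suc p))"
  have gP: "P (g p q)" if "\<forall>i<n. q i \<le> Suc p" for p q
    using that unfolding P_def g_def by (auto simp: field_simps simp del: of_nat_Suc)
  \<comment> \<open>The grid has mesh \<open>1 / Suc p\<close>; letting \<open>p\<close> range over all naturals avoids mesh size \<open>1 / 0\<close>.\<close>
  have "\<exists>q. (\<forall>i<n. q i < Suc p) \<and> (\<forall>i<n. \<exists>r s. (\<forall>j<n. q j \<le> r j \<and> r j \<le> q j + 1) \<and>
      (\<forall>j<n. q j \<le> s j \<and> s j \<le> q j + 1) \<and> lab (g p r) i \<noteq> lab (g p s) i)" for p
  proof (rule kuhn_lemma[of "Suc p" n "\<lambda>x. lab (g p x)"])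
    show "\<forall>x. (\<forall>i<n. x i \<le> Suc p) \<longrightarrow> (\<forall>i<n. lab (g p x) i = 0 \<or> lab (g p x) i = 1)"
      using lab(1) by (metis One_nat_def le_Suc_eq le_zero_eq)
    show "\<forall>x. (\<forall>i<n. x i \<le> Suc p) \<longrightarrow> (\<forall>i<n. x i = 0 \<longrightarrow> lab (g p x) i = 0)"
      using lab(2) gP by (auto simp: g_def)
    show "\<forall>x. (\<forall>i<n. x i \<le> Suc p) \<longrightarrow> (\<forall>i<n. x i = Suc p \<longrightarrow> lab (g p x) i = 1)"
    proof (intro allI impI)
      fix x i assume "\<forall>i<n. x i \<le> Suc p" and i: "i < n" "x i = Suc p"
      then have "P (g p x)" by (intro gP)
      then show "lab (g p x) i = 1" using i by (intro lab(3)) (auto simp: g_def)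
    qed
  qed auto
  then have "\<forall>p. \<exists>q. (\<forall>i<n. q i < Suc p) \<and> (\<forall>i<n. \<exists>r s. (\<forall>j<n. q j \<le> r j \<and> r j \<le> q j + 1) \<and>
      (\<forall>j<n. q j \<le> s j \<and> s j \<le> q j + 1) \<and> lab (g p r) i \<noteq> lab (g p s) i)" by blast
  from choice[OF this] obtain q where q: "\<And>p i. i < n \<Longrightarrow> q p i < Suc p"
    and rs: "\<And>p i. i < n \<Longrightarrow> \<exists>r s. (\<forall>j<n. q p j \<le> r j \<and> r j \<le> q p j + 1) \<and>
      (\<forall>j<n. q p j \<le> s j \<and> s j \<le> q p j + 1) \<and> lab (g p r) i \<noteq> lab (g p s) i"
    by blast
  have gq: "g p (q p) i \<in> {0..1}" if "i < n" for p i
    using gP[of "q p" p] q[of _ p] that by (auto simp: P_def less_imp_le)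
  have "\<exists>x \<sigma>. strict_mono (\<sigma>::nat\<Rightarrow>nat) \<and> (\<forall>i<n. (\<lambda>k. g (\<sigma> k) (q (\<sigma> k)) i) \<longlonglongrightarrow> x i) \<and>
      (\<forall>i<n. x i \<in> {0..1})"
    by (rule cube_seq_compact) (rule gq)
  then obtain x where "\<exists>\<sigma>. strict_mono (\<sigma>::nat\<Rightarrow>nat) \<and>
      (\<forall>i<n. (\<lambda>k. g (\<sigma> k) (q (\<sigma> k)) i) \<longlonglongrightarrow> x i) \<and> (\<forall>i<n. x i \<in> {0..1})" ..
  then obtain \<sigma> where *: "strict_mono (\<sigma>::nat\<Rightarrow>nat) \<and>
      (\<forall>i<n. (\<lambda>k. g (\<sigma> k) (q (\<sigma> k)) i) \<longlonglongrightarrow> x i) \<and> (\<forall>i<n. x i \<in> {0..1})" ..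
  then have \<sigma>: "strict_mono \<sigma>"
    and lim: "\<And>i. i < n \<Longrightarrow> (\<lambda>k. g (\<sigma> k) (q (\<sigma> k)) i) \<longlonglongrightarrow> x i"
    and x: "\<And>i. i < n \<Longrightarrow> x i \<in> {0..1}"
    by simp_all
  have F1: "F x i = x i" if i: "i < n" for i
  proof -
    \<comment> \<open>Any choice of vertices of the cells has the same limit as the base points.\<close>
    have near: "(\<lambda>k. g (\<sigma> k) (r (\<sigma> k)) j) \<longlonglongrightarrow> x j"
      if r: "\<And>p j. j < n \<Longrightarrow> q p j \<le> r p j \<and> r p j \<le> q p j + 1" and j: "j < n" for r j
    proof (rule tendsto_sandwich[OF _ _ lim[OF j]])
      show "\<forall>\<^sub>F k in sequentially. g (\<sigma> k) (q (\<sigma> k)) j \<le> g (\<sigma> k) (r (\<sigma> k)) j"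
        using r j by (auto simp: g_def divide_right_mono)
      have "(\<lambda>k. inverse (real (Suc (\<sigma> k)))) \<longlonglongrightarrow> 0"
        using LIMSEQ_subseq_LIMSEQ[OF LIMSEQ_inverse_real_of_nat \<sigma>] by (simp add: o_def)
      from tendsto_add[OF lim[OF j] this]
      show "(\<lambda>k. g (\<sigma> k) (q (\<sigma> k)) j + inverse (real (Suc (\<sigma> k)))) \<longlonglongrightarrow> x j" by simp
      have "real (r p j) \<le> real (q p j) + 1" for p using r[OF j, of p] by linarith
      then show "\<forall>\<^sub>F k in sequentially. g (\<sigma> k) (r (\<sigma> k)) j
          \<le> g (\<sigma> k) (q (\<sigma> k)) j + inverse (real (Suc (\<sigma> k)))"
        by (auto simp: g_def divide_simps simp del: of_nat_Suc)
    qed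
    have "\<exists>a b. (\<forall>j<n. q p j \<le> a j \<and> a j \<le> q p j + 1) \<and>
      (\<forall>j<n. q p j \<le> b j \<and> b j \<le> q p j + 1) \<and> lab (g p a) i = 0 \<and> lab (g p b) i = 1" for p
    proof -
      obtain r s where *: "\<forall>j<n. q p j \<le> r j \<and> r j \<le> q p j + 1"
        "\<forall>j<n. q p j \<le> s j \<and> s j \<le> q p j + 1" "lab (g p r) i \<noteq> lab (g p s) i"
        using rs[OF i] by blast
      moreover have "lab (g p r) i = 0 \<or> lab (g p r) i = 1" "lab (g p s) i = 0 \<or> lab (g p s) i = 1"
        using lab(1)[of "g p r" i] lab(1)[of "g p s" i] by linarith+
      ultimately show ?thesis by metis
    qed
    then have "\<forall>p. \<exists>ab. (\<forall>j<n. q p j \<le> fst ab j \<and> fst ab j \<le> q p j + 1) \<and>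
      (\<forall>j<n. q p j \<le> snd ab j \<and> snd ab j \<le> q p j + 1) \<and>
      lab (g p (fst ab)) i = 0 \<and> lab (g p (snd ab)) i = 1" by simp
    from choice[OF this] obtain ab where ab: "\<forall>p. (\<forall>j<n. q p j \<le> fst (ab p) j \<and> fst (ab p) j \<le> q p j + 1) \<and>
      (\<forall>j<n. q p j \<le> snd (ab p) j \<and> snd (ab p) j \<le> q p j + 1) \<and>
      lab (g p (fst (ab p))) i = 0 \<and> lab (g p (snd (ab p))) i = 1" by blast
    define a b where "a = (\<lambda>p. fst (ab p))" and "b = (\<lambda>p. snd (ab p))"
    have a: "\<And>p j. j < n \<Longrightarrow> q p j \<le> a p j \<and> a p j \<le> q p j + 1"
      and b: "\<And>p j. j < n \<Longrightarrow> q p j \<le> b p j \<and> b p j \<le> q p j + 1"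
      and l: "\<And>p. lab (g p (a p)) i = 0" "\<And>p. lab (g p (b p)) i = 1"
      using ab unfolding a_def b_def by blast+
    have aP: "P (g p (a p))" and bP: "P (g p (b p))" for p
      using a[of _ p] b[of _ p] q[of _ p] by (intro gP allI impI; fastforce)+
    \<comment> \<open>Along the vertices of either label, the inequality that the label stands for passes to the limit.\<close>
    have "x i \<le> F x i"
    proof (rule LIMSEQ_le[OF near[OF a i]])
      show "(\<lambda>k. F (g (\<sigma> k) (a (\<sigma> k))) i) \<longlonglongrightarrow> F x i"
        using aP x near[OF a] i by (intro cont) (auto simp: P_def)
      show "\<exists>N. \<forall>k\<ge>N. g (\<sigma> k) (a (\<sigma> k)) i \<le> F (g (\<sigma> k) (a (\<sigma> k))) i"
        using lab(4)[OF aP i l(1)] by blast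
    qed
    moreover have "F x i \<le> x i"
    proof (rule LIMSEQ_le[OF _ near[OF b i]])
      show "(\<lambda>k. F (g (\<sigma> k) (b (\<sigma> k))) i) \<longlonglongrightarrow> F x i"
        using bP x near[OF b] i by (intro cont) (auto simp: P_def)
      show "\<exists>N. \<forall>k\<ge>N. F (g (\<sigma> k) (b (\<sigma> k))) i \<le> g (\<sigma> k) (b (\<sigma> k)) i"
        using lab(5)[OF bP i l(2)] by blast
    qed
    ultimately show ?thesis by simp
  qed
  then show ?thesis using x by blast
qed

text \<open>
  For each degree \<open>N\<close>, Brouwer's theorem gives a Bernstein polynomial \<open>v\<^sub>N\<close> whose coefficients are
  the values of \<open>w\<^sub>N = A v\<^sub>N\<close> at the nodes \<open>k/N\<close>.  The \<open>w\<^sub>N\<close> are uniformly Lipschitz, hence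
  converge uniformly along a subsequence, say to \<open>u\<close>.  The Bernstein operator does not
  increase the sup norm and reproduces \<open>u\<close> in the limit, so also \<open>v\<^sub>N \<longrightarrow> u\<close>, and continuity
  of \<open>A\<close> gives \<open>A u = u\<close>.
\<close>
lemma schauder_equi_Lipschitz:
  fixes A :: "(real \<Rightarrow> real) \<Rightarrow> real \<Rightarrow> real"
  assumes M: "M > 0"
    and range: "\<And>u t. continuous_on {0..1} u \<Longrightarrow> t \<in> {0..1} \<Longrightarrow> A u t \<in> {0..M}"
    and lip: "\<And>u s t. continuous_on {0..1} u \<Longrightarrow> s \<in> {0..1} \<Longrightarrow> t \<in> {0..1} \<Longrightarrow>
                \<bar>A u s - A u t\<bar> \<le> L * \<bar>s - t\<bar>"
    and cont: "\<And>v u t. (\<And>k. continuous_on {0..1} (v k)) \<Longrightarrow> continuous_on {0..1} u \<Longrightarrow>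
                uniform_limit {0..1} v u sequentially \<Longrightarrow> t \<in> {0..1} \<Longrightarrow>
                (\<lambda>k. A (v k) t) \<longlonglongrightarrow> A u t"
  shows "\<exists>u. continuous_on {0..1} u \<and> (\<forall>t\<in>{0..1}. A u t = u t)"
proof -
  define B where "B = (\<lambda>N x t. \<Sum>k\<le>N. x k * Bernstein N k t)"
  have contB: "continuous_on {0..1} (B N x)" for N x
    unfolding B_def Bernstein_def by (intro continuous_intros)
  have B_diff: "\<bar>B N x t - B N y t\<bar> \<le> e"
    if "\<And>k. k \<le> N \<Longrightarrow> \<bar>x k - y k\<bar> \<le> e" "t \<in> {0..1}" for N x y e t
  proof -
    have "\<bar>B N x t - B N y t\<bar> = \<bar>\<Sum>k\<le>N. (x k - y k) * Bernstein N k t\<bar>"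
      by (simp add: B_def left_diff_distrib sum_subtractf)
    also have "\<dots> \<le> (\<Sum>k\<le>N. \<bar>x k - y k\<bar> * Bernstein N k t)"
      using that(2) by (intro order_trans[OF sum_abs]) (auto intro!: sum_mono simp: abs_mult Bernstein_nonneg)
    also have "\<dots> \<le> (\<Sum>k\<le>N. e * Bernstein N k t)"
      using that by (intro sum_mono mult_right_mono) (auto simp: Bernstein_nonneg)
    finally show ?thesis by (simp add: sum_distrib_left[symmetric])
  qed
  have "\<exists>x. \<forall>k\<le>N. A (B N x) (k / N) = x k" for N :: nat
  proof -
    define F where "F = (\<lambda>x k. A (B N (\<lambda>j. M * x j)) (real k / real N) / M)"
    have kN: "real k / real N \<in> {0..1}" if "k < Suc N" for k
      using that by (cases "N = 0") (auto simp: field_simps)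
    have "\<exists>x. (\<forall>i<Suc N. x i \<in> {0..1}) \<and> (\<forall>i<Suc N. F x i = x i)"
    proof (rule brouwer_nat_cube)
      fix x i assume "i < Suc N"
      then show "F x i \<in> {0..1}"
        using range[OF contB kN, of i] M unfolding F_def by (auto simp: field_simps)
    next
      fix X :: "nat \<Rightarrow> nat \<Rightarrow> real" and x i
      assume X: "\<And>j. j < Suc N \<Longrightarrow> (\<lambda>k. X k j) \<longlonglongrightarrow> x j" and i: "i < Suc N"
      have "uniform_limit {0..1} (\<lambda>k. B N (\<lambda>j. M * X k j)) (B N (\<lambda>j. M * x j)) sequentially"
      proof (rule uniform_limitI)
        fix e :: real assume "e > 0"
        then have "\<forall>\<^sub>F k in sequentially. \<forall>j\<in>{..N}. \<bar>X k j - x j\<bar> < e / (2 * M)"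
          using X M by (intro eventually_ball_finite) (auto simp: tendsto_iff dist_real_def)
        then show "\<forall>\<^sub>F k in sequentially. \<forall>t\<in>{0..1}. dist (B N (\<lambda>j. M * X k j) t) (B N (\<lambda>j. M * x j) t) < e"
        proof eventually_elim
          case (elim k)
          have "\<bar>M * X k j - M * x j\<bar> \<le> e / 2" if "j \<le> N" for j
          proof -
            have "\<bar>M * X k j - M * x j\<bar> = M * \<bar>X k j - x j\<bar>"
              using M by (simp add: abs_mult right_diff_distrib[symmetric])
            also have "\<dots> \<le> e / 2" using elim that M by (auto simp: field_simps less_imp_le)
            finally show ?thesis .
          qed
          then show ?case using B_diff[of N "\<lambda>j. M * X k j" "\<lambda>j. M * x j" "e/2"] \<open>e > 0\<close>
            by (fastforce simp: dist_real_def)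
        qed
      qed
      then show "(\<lambda>k. F (X k) i) \<longlonglongrightarrow> F x i"
        unfolding F_def using M by (intro tendsto_intros cont contB kN i) auto
    qed
    then obtain x where "\<forall>i\<le>N. F x i = x i" by (auto simp: less_Suc_eq_le)
    then have "\<forall>k\<le>N. A (B N (\<lambda>j. M * x j)) (k / N) = M * x k"
      using M by (auto simp: F_def field_simps)
    then show ?thesis by (intro exI[of _ "\<lambda>k. M * x k"])
  qed
  then obtain x where x: "\<And>N k. k \<le> N \<Longrightarrow> A (B N (x N)) (k / N) = x N k" by metis
  define w where "w = (\<lambda>N. A (B N (x N)))"
  have Bw: "B N (x N) t = (\<Sum>k\<le>N. w N (k/N) * Bernstein N k t)" for N t
  proof -
    have "B N (x N) t = (\<Sum>k\<le>N. x N k * Bernstein N k t)" by (simp add: B_def)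
    also have "\<dots> = (\<Sum>k\<le>N. w N (k/N) * Bernstein N k t)"
      using x by (intro sum.cong) (auto simp: w_def)
    finally show ?thesis .
  qed
  obtain u \<sigma> where u: "continuous_on {0..1} u" and \<sigma>: "strict_mono (\<sigma>::nat\<Rightarrow>nat)"
    and lim: "\<And>e. 0 < e \<Longrightarrow> \<exists>N. \<forall>n t. n \<ge> N \<and> t \<in> {0..1} \<longrightarrow> norm (w (\<sigma> n) t - u t) < e"
  proof (rule Arzela_Ascoli[of "{0..1::real}" w M])
    show "norm (w N t) \<le> M" if "t \<in> {0..1}" for N t
      using range[OF contB that, of N "x N"] by (auto simp: w_def)
    fix t e :: real assume t: "t \<in> {0..1}" and e: "0 < e"
    have "norm (w N t - w N s) < e" if "s \<in> {0..1}" "norm (t - s) < e / (\<bar>L\<bar> + 1)" for N s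
    proof -
      have "norm (w N t - w N s) \<le> L * \<bar>t - s\<bar>"
        using lip[OF contB t that(1)] by (simp add: w_def)
      also have "\<dots> \<le> (\<bar>L\<bar> + 1) * \<bar>t - s\<bar>" by (intro mult_right_mono) auto
      also have "\<dots> < e" using that(2) by (simp add: field_simps)
      finally show ?thesis .
    qed
    then show "\<exists>d. 0 < d \<and> (\<forall>N s. s \<in> {0..1} \<and> norm (t - s) < d \<longrightarrow> norm (w N t - w N s) < e)"
      using e by (intro exI[of _ "e / (\<bar>L\<bar> + 1)"]) auto
  qed auto
  have unif: "uniform_limit {0..1} (\<lambda>n. B (\<sigma> n) (x (\<sigma> n))) u sequentially"
  proof (rule uniform_limitI)
    fix e :: real assume e: "e > 0"
    obtain N1 where N1: "\<And>n t. n \<ge> N1 \<Longrightarrow> t \<in> {0..1} \<Longrightarrow> \<bar>w (\<sigma> n) t - u t\<bar> < e / 2"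
      using lim[of "e/2"] e by auto
    obtain N2 where N2: "\<And>n t. n \<ge> N2 \<Longrightarrow> t \<in> {0..1} \<Longrightarrow>
        \<bar>u t - (\<Sum>k\<le>n. u (k/n) * Bernstein n k t)\<bar> < e / 2"
      using Bernstein_Weierstrass[OF u, of "e/2"] e by auto
    have "dist (B (\<sigma> n) (x (\<sigma> n)) t) (u t) < e" if n: "n \<ge> max N1 N2" and t: "t \<in> {0..1}" for n t
    proof -
      have kN: "real k / real (\<sigma> n) \<in> {0..1}" if "k \<le> \<sigma> n" for k
        using that by (cases "\<sigma> n = 0") (auto simp: field_simps)
      have "\<bar>B (\<sigma> n) (x (\<sigma> n)) t - B (\<sigma> n) (\<lambda>k. u (k / \<sigma> n)) t\<bar> \<le> e / 2"
      proof (rule B_diff[OF _ t])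
        fix k assume "k \<le> \<sigma> n"
        then show "\<bar>x (\<sigma> n) k - u (k / \<sigma> n)\<bar> \<le> e / 2"
          using N1[OF _ kN, of n k] n x[of k "\<sigma> n"] unfolding w_def by simp
      qed
      moreover have "\<bar>u t - B (\<sigma> n) (\<lambda>k. u (k / \<sigma> n)) t\<bar> < e / 2"
        unfolding B_def using N2[of "\<sigma> n" t] n t seq_suble[OF \<sigma>, of n] by auto
      ultimately show ?thesis unfolding dist_real_def by linarith
    qed
    then show "\<forall>\<^sub>F n in sequentially. \<forall>t\<in>{0..1}. dist (B (\<sigma> n) (x (\<sigma> n)) t) (u t) < e"
      unfolding eventually_sequentially by (intro exI[of _ "max N1 N2"]) blast
  qed
  have "A u t = u t" if t: "t \<in> {0..1}" for t
  proof (rule LIMSEQ_unique)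
    show "(\<lambda>n. w (\<sigma> n) t) \<longlonglongrightarrow> A u t"
      unfolding w_def by (rule cont[OF contB u unif t])
    show "(\<lambda>n. w (\<sigma> n) t) \<longlonglongrightarrow> u t"
      using lim t unfolding LIMSEQ_def dist_norm by blast
  qed
  with u show ?thesis by blast
qed

section \<open>The linear problem with clamped boundary values\<close>

text \<open>
  Up to the factor \<open>k!\<close> this is the \<open>(k + 1)\<close>-fold iterated integral of \<open>h\<close> from \<open>0\<close>.
\<close>
definition volterra :: "nat \<Rightarrow> (real \<Rightarrow> real) \<Rightarrow> real \<Rightarrow> real" where
  "volterra k h t = integral {0..t} (\<lambda>s. (t - s) ^ k * h s)"

text \<open>
  Splitting one factor \<open>t - s\<close> moves the dependence on \<open>t\<close> out of the integrand, which reduces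
  differentiation to the product rule and induction on \<open>k\<close>.
\<close>
lemma volterra_Suc:
  assumes h: "continuous_on {0..1} h" and t: "t \<in> {0..1}"
  shows "volterra (Suc k) h t = t * volterra k h t - volterra k (\<lambda>s. s * h s) t"
proof -
  have h': "continuous_on {0..t} h" using h t by (auto intro: continuous_on_subset)
  have "volterra (Suc k) h t = integral {0..t} (\<lambda>s. t * ((t - s) ^ k * h s) - (t - s) ^ k * (s * h s))"
    unfolding volterra_def by (intro arg_cong[of _ _ "integral {0..t}"]) (auto simp: algebra_simps)
  also have "\<dots> = integral {0..t} (\<lambda>s. t * ((t - s) ^ k * h s)) - integral {0..t} (\<lambda>s. (t - s) ^ k * (s * h s))"
    using h' by (intro integral_diff integrable_continuous_real continuous_intros)
  finally show ?thesis by (simp add: volterra_def)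
qed

lemma volterra_0_deriv:
  assumes "continuous_on {0..1} h" "t \<in> {0..1}"
  shows "(volterra 0 h has_real_derivative h t) (at t within {0..1})"
  using integral_has_real_derivative[OF assms] by (simp add: volterra_def[abs_def])

lemma volterra_Suc_deriv:
  assumes "continuous_on {0..1} h" "t \<in> {0..1}"
  shows "(volterra (Suc k) h has_real_derivative (real k + 1) * volterra k h t) (at t within {0..1})"
  using assms(1)
proof (induction k arbitrary: h)
  case 0
  have sh: "continuous_on {0..1} (\<lambda>s. s * h s)" using 0 by (intro continuous_intros)
  have "((\<lambda>t. t * volterra 0 h t - volterra 0 (\<lambda>s. s * h s) t) has_real_derivative
      volterra 0 h t) (at t within {0..1})"
    by (rule derivative_eq_intros volterra_0_deriv 0 sh assms(2) refl | simp)+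
  then show ?case
    by (subst has_field_derivative_cong_eventually
      [where g = "\<lambda>t. t * volterra 0 h t - volterra 0 (\<lambda>s. s * h s) t"])
       (auto simp: volterra_Suc[OF 0] volterra_Suc[OF 0 assms(2)] eventually_at_filter)
next
  case (Suc k)
  have sh: "continuous_on {0..1} (\<lambda>s. s * h s)" using Suc.prems by (intro continuous_intros)
  have "((\<lambda>t. t * volterra (Suc k) h t - volterra (Suc k) (\<lambda>s. s * h s) t) has_real_derivative
      (real (Suc k) + 1) * volterra (Suc k) h t) (at t within {0..1})"
    by (rule derivative_eq_intros Suc.IH Suc.prems sh assms(2) refl
        | simp add: volterra_Suc[OF Suc.prems assms(2)] algebra_simps)+
  then show ?case
    by (subst has_field_derivative_cong_eventually
      [where g = "\<lambda>t. t * volterra (Suc k) h t - volterra (Suc k) (\<lambda>s. s * h s) t"])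
       (auto simp: volterra_Suc[OF Suc.prems, where k = "Suc k"]
          volterra_Suc[OF Suc.prems assms(2), where k = "Suc k"] eventually_at_filter)
qed

text \<open>
  The middle estimate follows from \<open>t - s \<le> t (1 - s)\<close> for \<open>0 \<le> s \<le> t \<le> 1\<close>, and it is the source of
  monotonicity and of the cubic lower bound for the linear problem.
\<close>
lemma volterra_bounds:
  assumes h: "continuous_on {0..1} h" "\<And>s. s \<in> {0..1} \<Longrightarrow> 0 \<le> h s \<and> h s \<le> m" and t: "t \<in> {0..1}"
  shows "0 \<le> volterra k h t" "volterra k h t \<le> t ^ k * volterra k h 1" "volterra k h 1 \<le> m"
proof -
  have h': "continuous_on {0..t} h" using h t by (auto intro: continuous_on_subset)
  show "0 \<le> volterra k h t" unfolding volterra_def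
    using h t by (intro integral_nonneg integrable_continuous_real continuous_intros h') auto
  have "volterra k h t \<le> integral {0..t} (\<lambda>s. t ^ k * ((1 - s) ^ k * h s))"
    unfolding volterra_def
  proof (intro integral_le integrable_continuous_real continuous_intros h')
    fix s assume s: "s \<in> {0..t}"
    have "(t - s) ^ k \<le> (t * (1 - s)) ^ k"
      using s t by (intro power_mono) (auto simp: right_diff_distrib mult_left_le_one_le mult_le_cancel_right1)
    then show "(t - s) ^ k * h s \<le> t ^ k * ((1 - s) ^ k * h s)"
      using h s t by (auto simp: power_mult_distrib mult.assoc[symmetric] intro!: mult_right_mono)
  qed
  also have "\<dots> \<le> integral {0..1} (\<lambda>s. t ^ k * ((1 - s) ^ k * h s))"
    using h t h' by (intro integral_subset_le integrable_continuous_real continuous_intros) auto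
  also have "\<dots> = t ^ k * volterra k h 1" by (simp add: volterra_def)
  finally show "volterra k h t \<le> t ^ k * volterra k h 1" .
  have "volterra k h 1 \<le> integral {0..1} (\<lambda>s::real. m)"
    unfolding volterra_def
  proof (intro integral_le integrable_continuous_real continuous_intros h)
    fix s :: real assume s: "s \<in> {0..1}"
    have "(1 - s) ^ k * h s \<le> 1 * m"
      using s h by (intro mult_mono power_le_one) (auto intro: order_trans)
    then show "(1 - s) ^ k * h s \<le> m" by simp
  qed
  then show "volterra k h 1 \<le> m" by simp
qed

lemma volterra_tendsto:
  assumes "\<And>k. continuous_on {0..1} (h k)"
    and "\<And>k s. s \<in> {0..1} \<Longrightarrow> \<bar>h k s\<bar> \<le> m"
    and "\<And>s. s \<in> {0..1} \<Longrightarrow> (\<lambda>k. h k s) \<longlonglongrightarrow> g s"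
    and t: "t \<in> {0..1}"
  shows "(\<lambda>k. volterra j (h k) t) \<longlonglongrightarrow> volterra j g t"
  unfolding volterra_def
proof (rule dominated_convergence(2))
  show "(\<lambda>s. (t - s) ^ j * h k s) integrable_on {0..t}" for k
    using t by (intro integrable_continuous_real continuous_intros continuous_on_subset[OF assms(1)]) auto
  show "(\<lambda>s. m) integrable_on {0..t}" by auto
  show "norm ((t - s) ^ j * h k s) \<le> m" if "s \<in> {0..t}" for k s
  proof -
    have "\<bar>(t - s) ^ j\<bar> * \<bar>h k s\<bar> \<le> 1 * m"
      using that t assms(2) by (intro mult_mono) (auto simp: power_abs intro!: power_le_one)
    then show ?thesis by (simp add: abs_mult)
  qed
  show "(\<lambda>k. (t - s) ^ j * h k s) \<longlonglongrightarrow> (t - s) ^ j * g s" if "s \<in> {0..t}" for s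
    using that t by (intro tendsto_intros assms(3)) auto
qed

text \<open>
  The integral of \<open>h\<close> against the Green function of \<open>- w'''' = h\<close>,
  \<open>w(0) = w'(0) = w''(0) = w'(1) = 0\<close>.
\<close>
definition green :: "(real \<Rightarrow> real) \<Rightarrow> real \<Rightarrow> real" where
  "green h t = (t ^ 3 * volterra 2 h 1 - volterra 3 h t) / 6"

lemma green_0: "green h 0 = 0"
  by (simp add: green_def volterra_def)

lemma green_deriv:
  assumes h: "continuous_on {0..1} h" and t: "t \<in> {0..1}"
  shows "(green h has_real_derivative (t\<^sup>2 * volterra 2 h 1 - volterra 2 h t) / 2) (at t within {0..1})"
proof -
  have "((\<lambda>t. (t ^ 3 * volterra 2 h 1 - volterra (Suc 2) h t) / 6) has_real_derivative
     (t\<^sup>2 * volterra 2 h 1 - volterra 2 h t) / 2) (at t within {0..1})"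
    by (rule derivative_eq_intros volterra_Suc_deriv h t refl | simp add: field_simps)+
  then show ?thesis by (simp add: green_def[abs_def] numeral_3_eq_3 numeral_2_eq_2)
qed

context
  fixes h :: "real \<Rightarrow> real" and m :: real
  assumes h: "continuous_on {0..1} h" "\<And>s. s \<in> {0..1} \<Longrightarrow> 0 \<le> h s \<and> h s \<le> m"
begin

text \<open>
  Both are bounds \<open>0 \<le> w' \<le> m\<close> on the derivative, passed on by the mean value theorem.
\<close>
lemma green_mono_Lipschitz:
  assumes st: "0 \<le> s" "s \<le> t" "t \<le> 1"
  shows "green h s \<le> green h t" "green h t - green h s \<le> m * (t - s)"
proof -
  obtain x where x: "x \<in> {s..t}" and eq: "green h t - green h s =
      (t - s) * ((x\<^sup>2 * volterra 2 h 1 - volterra 2 h x) / 2)"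
  proof (cases "s = t")
    case True
    then show ?thesis using that by auto
  next
    case False
    then have "\<exists>x\<in>{s<..<t}. green h t - green h s = (t - s) * ((x\<^sup>2 * volterra 2 h 1 - volterra 2 h x) / 2)"
      using st False
      by (intro mvt_simple[of s t "green h" "\<lambda>x d. d * ((x\<^sup>2 * volterra 2 h 1 - volterra 2 h x) / 2)"]
          has_derivative_subset[OF green_deriv[OF h(1), unfolded has_field_derivative_def, THEN has_derivative_eq_rhs]])
         (auto simp: mult.commute)
    then show ?thesis using that by (meson greaterThanLessThan_iff atLeastAtMost_iff less_imp_le)
  qed
  have x1: "x \<in> {0..1}" using x st by auto
  note b = volterra_bounds[OF h x1, of 2]
  show "green h s \<le> green h t"
    using b(2) eq st(2) by (smt (verit) divide_nonneg_pos mult_nonneg_nonneg)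
  have "x\<^sup>2 * volterra 2 h 1 \<le> 1 * m"
    using x1 b volterra_bounds[OF h, of 1 2] by (intro mult_mono power_le_one) auto
  then have "(x\<^sup>2 * volterra 2 h 1 - volterra 2 h x) / 2 \<le> m"
    using b volterra_bounds[OF h, of 1 2] by (simp add: field_simps)
  then show "green h t - green h s \<le> m * (t - s)"
    unfolding eq using mult_left_mono[of "(x\<^sup>2 * volterra 2 h 1 - volterra 2 h x) / 2" m "t - s"] st(2)
    by (simp only: mult.commute[of m] diff_ge_0_iff_ge)
qed

lemma green_continuous: "continuous_on {0..1} (green h)"
  using green_deriv[OF h(1)] by (rule DERIV_continuous_on)

lemma green_cubic:
  assumes t: "t \<in> {0..1}"
  shows "t ^ 3 * green h 1 \<le> green h t"
  using volterra_bounds(2)[OF h t, of 3] by (simp add: green_def field_simps)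

lemma green_nonneg: "t \<in> {0..1} \<Longrightarrow> 0 \<le> green h t"
  using green_mono_Lipschitz(1)[of 0 t] by (simp add: green_0)

lemma green_le_1: "t \<in> {0..1} \<Longrightarrow> green h t \<le> green h 1"
  using green_mono_Lipschitz(1)[of t 1] by simp

lemma green_1_le: "green h 1 \<le> m"
  using green_mono_Lipschitz(2)[of 0 1] by (simp add: green_0)

text \<open>
  The kernel at \<open>t = 1\<close> is \<open>s (1 - s)\<^sup>2 / 6\<close>, which is at least \<open>1/192\<close> on an interval of length
  \<open>1/4\<close>; hence the constant \<open>768\<close>.
\<close>
lemma green_1_ge:
  assumes b: "\<And>s. s \<in> {1/2..3/4} \<Longrightarrow> b \<le> h s" and "0 \<le> b"
  shows "b / 768 \<le> green h 1"
proof -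
  have "b / 128 = integral {1/2..3/4} (\<lambda>s::real. b / 32)" by simp
  also have "\<dots> \<le> integral {1/2..3/4} (\<lambda>s. (1 - s)\<^sup>2 * (s * h s))"
  proof (intro integral_le integrable_continuous_real continuous_intros continuous_on_subset[OF h(1)])
    fix s :: real assume s: "s \<in> {1/2..3/4}"
    have "(1/4)\<^sup>2 * (1/2 * b) \<le> (1 - s)\<^sup>2 * (s * h s)"
      using s b[OF s] \<open>0 \<le> b\<close> by (intro mult_mono power_mono) auto
    then show "b / 32 \<le> (1 - s)\<^sup>2 * (s * h s)" by (simp add: power2_eq_square)
  qed auto
  also have "\<dots> \<le> integral {0..1} (\<lambda>s. (1 - s)\<^sup>2 * (s * h s))"
    using h by (intro integral_subset_le integrable_continuous_real continuous_intros
        continuous_on_subset[OF h(1)]) auto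
  also have "\<dots> = volterra 2 h 1 - volterra 3 h 1"
    using volterra_Suc[OF h(1), of 1 2] by (simp add: volterra_def numeral_3_eq_3 numeral_2_eq_2)
  finally show ?thesis by (simp add: green_def)
qed

end

lemma green_tendsto:
  assumes "\<And>k. continuous_on {0..1} (h k)"
    and "\<And>k s. s \<in> {0..1} \<Longrightarrow> \<bar>h k s\<bar> \<le> m"
    and "\<And>s. s \<in> {0..1} \<Longrightarrow> (\<lambda>k. h k s) \<longlonglongrightarrow> g s"
    and "t \<in> {0..1}"
  shows "(\<lambda>k. green (h k) t) \<longlonglongrightarrow> green g t"
  unfolding green_def by (intro tendsto_intros volterra_tendsto[OF assms(1-3)] assms) auto

lemma green_cong:
  assumes "\<And>s. s \<in> {0..1} \<Longrightarrow> h s = g s" "t \<in> {0..1}"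
  shows "green h t = green g t"
proof -
  have "volterra k h t = volterra k g t" if "t \<in> {0..1}" for k t
    unfolding volterra_def using assms(1) that by (intro integral_cong) auto
  then show ?thesis using assms(2) by (simp add: green_def)
qed

text \<open>
  One-sided differentiation on \<open>[0,1]\<close> sees only values on \<open>[0,1]\<close>, so the next iterated derivative
  may be computed from any function \<open>g\<close> that agrees there with the previous one.
\<close>
lemma deriv01_Suc:
  assumes eq: "\<And>t. t \<in> {0..1} \<Longrightarrow> deriv01 k u t = g t"
    and g: "\<And>t. t \<in> {0..1} \<Longrightarrow> (g has_real_derivative g' t) (at t within {0..1})"
    and t: "t \<in> {0..1}"
  shows "(deriv01 k u has_real_derivative g' t) (at t within {0..1})" "deriv01 (Suc k) u t = g' t"
proof -
  show d: "(deriv01 k u has_real_derivative g' t) (at t within {0..1})"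
    by (rule has_field_derivative_transform_within[OF g[OF t] zero_less_one t]) (simp add: eq)
  have "deriv01 (Suc k) u t = vector_derivative (deriv01 k u) (at t within {0..1})"
    by (simp add: deriv01_def)
  also have "\<dots> = g' t"
    using d t by (intro vector_derivative_within_closed_interval)
      (auto simp: has_real_derivative_iff_has_vector_derivative)
  finally show "deriv01 (Suc k) u t = g' t" .
qed

lemma green_shift_C4:
  fixes h u :: "real \<Rightarrow> real" and c :: real
  assumes h: "continuous_on {0..1} h"
  defines "u \<equiv> (\<lambda>t. green h t + c)"
  shows "C4_01 u" "t \<in> {0..1} \<Longrightarrow> deriv01 4 u t = - h t"
    "deriv01 1 u 0 = 0" "deriv01 1 u 1 = 0" "deriv01 2 u 0 = 0"
proof -
  let ?V = "\<lambda>k. volterra k h"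
  have V: "(?V 0 has_real_derivative h t) (at t within {0..1})"
    "(?V 1 has_real_derivative ?V 0 t) (at t within {0..1})"
    "(?V 2 has_real_derivative 2 * ?V 1 t) (at t within {0..1})" if "t \<in> {0..1}" for t
    using volterra_0_deriv[OF h that] volterra_Suc_deriv[OF h that, of 0] volterra_Suc_deriv[OF h that, of 1]
    by (simp_all add: numeral_2_eq_2)
  define g1 g2 g3 where "g1 = (\<lambda>t. (t\<^sup>2 * ?V 2 1 - ?V 2 t) / 2)"
    and "g2 = (\<lambda>t. t * ?V 2 1 - ?V 1 t)" and "g3 = (\<lambda>t. ?V 2 1 - ?V 0 t)"
  have D0: "(u has_real_derivative g1 t) (at t within {0..1})" if "t \<in> {0..1}" for t
    unfolding u_def g1_def by (rule derivative_eq_intros green_deriv h that refl | simp)+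
  have D1: "(g1 has_real_derivative g2 t) (at t within {0..1})" if "t \<in> {0..1}" for t
    unfolding g1_def g2_def by (rule derivative_eq_intros V that refl | simp add: field_simps)+
  have D2: "(g2 has_real_derivative g3 t) (at t within {0..1})" if "t \<in> {0..1}" for t
    unfolding g2_def g3_def by (rule derivative_eq_intros V that refl | simp)+
  have D3: "(g3 has_real_derivative - h t) (at t within {0..1})" if "t \<in> {0..1}" for t
    unfolding g3_def by (rule derivative_eq_intros V that refl | simp)+
  have u0: "deriv01 0 u t = u t" for t by (simp add: deriv01_def)
  have E1: "(deriv01 0 u has_real_derivative g1 t) (at t within {0..1})" "deriv01 1 u t = g1 t"
    if "t \<in> {0..1}" for t
    using deriv01_Suc[of 0 u u g1, OF u0 D0 that] by auto
  have E2: "(deriv01 1 u has_real_derivative g2 t) (at t within {0..1})" "deriv01 2 u t = g2 t"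
    if "t \<in> {0..1}" for t
    using deriv01_Suc[of 1 u g1 g2, OF E1(2) D1 that] by (auto simp: numeral_2_eq_2)
  have E3: "(deriv01 2 u has_real_derivative g3 t) (at t within {0..1})" "deriv01 3 u t = g3 t"
    if "t \<in> {0..1}" for t
    using deriv01_Suc[of 2 u g2 g3, OF E2(2) D2 that] by (auto simp: numeral_3_eq_3)
  have E4: "(deriv01 3 u has_real_derivative - h t) (at t within {0..1})" "deriv01 4 u t = - h t"
    if "t \<in> {0..1}" for t
    using deriv01_Suc[of 3 u g3 "\<lambda>t. - h t", OF E3(2) D3 that] by auto
  have E4': "deriv01 4 u t = - h t" if "t \<in> {0..1}" for t
    using E4(2)[OF that] .
  then show "t \<in> {0..1} \<Longrightarrow> deriv01 4 u t = - h t" .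
  have "deriv01 k u differentiable_on {0..1}" if "k < 4" for k
  proof -
    have "k = 0 \<or> k = 1 \<or> k = 2 \<or> k = 3" using that by linarith
    then have "(deriv01 k u has_real_derivative
        (if k = 0 then g1 t else if k = 1 then g2 t else if k = 2 then g3 t else - h t)) (at t within {0..1})"
      if "t \<in> {0..1}" for t
      using E1(1)[OF that] E2(1)[OF that] E3(1)[OF that] E4(1)[OF that] by auto
    then show ?thesis
      unfolding differentiable_on_def real_differentiable_def by blast
  qed
  moreover have "continuous_on {0..1} (deriv01 4 u)"
    using continuous_on_cong[of "{0..1}" "{0..1}" "deriv01 4 u" "\<lambda>t. - h t"] E4' h
    by (auto intro: continuous_intros)
  ultimately show "C4_01 u" by (simp add: C4_01_def)
  show "deriv01 1 u 0 = 0" using E1(2)[of 0] by (simp add: g1_def volterra_def)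
  show "deriv01 1 u 1 = 0" using E1(2)[of 1] by (simp add: g1_def)
  show "deriv01 2 u 0 = 0" using E2(2)[of 0] by (simp add: g2_def volterra_def)
qed

section \<open>The nonlocal boundary condition\<close>

locale nonlocal_condition =
  fixes \<alpha> :: real and n :: nat and \<beta> \<eta> :: "nat \<Rightarrow> real"
  assumes alpha: "0 \<le> \<alpha>" and beta: "\<And>i. i \<in> {1..n} \<Longrightarrow> 0 \<le> \<beta> i"
    and eta: "\<And>i. i \<in> {1..n} \<Longrightarrow> \<eta> i \<in> {0..1}"
    and less_1: "\<alpha> + (\<Sum>i=1..n. \<beta> i) < 1"
begin

definition mass :: real where "mass = \<alpha> + (\<Sum>i=1..n. \<beta> i)"

definition average :: "(real \<Rightarrow> real) \<Rightarrow> real" where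
  "average u = \<alpha> * integral {0..1} u + (\<Sum>i=1..n. \<beta> i * u (\<eta> i))"

text \<open>
  If \<open>u = w + c\<close> with a constant \<open>c\<close> and \<open>w(0) = 0\<close>, the nonlocal condition reads
  \<open>c = average w + mass * c\<close>.
\<close>
definition solve :: "(real \<Rightarrow> real) \<Rightarrow> real \<Rightarrow> real" where
  "solve h t = green h t + average (green h) / (1 - mass)"

lemma mass_less_1: "mass < 1"
  using less_1 by (simp add: mass_def)

lemma average_mono:
  assumes "continuous_on {0..1} u" "continuous_on {0..1} v" "\<And>t. t \<in> {0..1} \<Longrightarrow> u t \<le> v t"
  shows "average u \<le> average v"
  unfolding average_def
  using assms alpha beta eta
  by (intro add_mono mult_left_mono sum_mono integral_le integrable_continuous_real) auto

lemma average_const: "average (\<lambda>_. c) = mass * c"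
  by (simp add: average_def mass_def sum_distrib_right distrib_right)

lemma average_add_const:
  assumes "continuous_on {0..1} u"
  shows "average (\<lambda>t. u t + c) = average u + mass * c"
proof -
  have "integral {0..1} (\<lambda>t. u t + c) = integral {0..1} u + c"
    using integral_add[OF integrable_continuous_real[OF assms] integrable_const_ivl[of c 0 "1::real"]] by simp
  then show ?thesis
    by (simp add: average_def mass_def algebra_simps sum.distrib sum_distrib_left)
qed

lemma average_cong:
  assumes "\<And>t. t \<in> {0..1} \<Longrightarrow> u t = v t"
  shows "average u = average v"
  unfolding average_def using assms eta by (intro arg_cong2[where f = "(+)"] arg_cong2[where f = "(*)"]
    refl integral_cong sum.cong) auto

lemma solve_cong:
  assumes "\<And>s. s \<in> {0..1} \<Longrightarrow> h s = g s" "t \<in> {0..1}"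
  shows "solve h t = solve g t"
  using green_cong[of h g, OF assms(1)] average_cong[of "green h" "green g"] assms(2)
  by (simp add: solve_def)

lemma solve_boundary:
  assumes h: "continuous_on {0..1} h" "\<And>s. s \<in> {0..1} \<Longrightarrow> 0 \<le> h s \<and> h s \<le> m"
  shows "solve h 0 = average (solve h)"
proof -
  have "average (solve h) = average (green h) + mass * (average (green h) / (1 - mass))"
    unfolding solve_def by (rule average_add_const[OF green_continuous[OF h]])
  also have "\<dots> = average (green h) / (1 - mass)"
    using mass_less_1 by (simp add: field_simps)
  finally show ?thesis by (simp add: solve_def green_0)
qed

text \<open>
  Pointwise convergence of bounded right-hand sides suffices, by dominated convergence.
\<close>
lemma solve_tendsto:
  assumes h: "\<And>k. continuous_on {0..1} (h k)" "\<And>k s. s \<in> {0..1} \<Longrightarrow> 0 \<le> h k s \<and> h k s \<le> m"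
    and lim: "\<And>s. s \<in> {0..1} \<Longrightarrow> (\<lambda>k. h k s) \<longlonglongrightarrow> g s"
    and t: "t \<in> {0..1}"
  shows "(\<lambda>k. solve (h k) t) \<longlonglongrightarrow> solve g t"
proof -
  have G: "(\<lambda>k. green (h k) t) \<longlonglongrightarrow> green g t" if "t \<in> {0..1}" for t
    using h by (intro green_tendsto[of h m, OF h(1) _ lim that]) (auto simp: abs_le_iff intro: order_trans)
  have "(\<lambda>k. integral {0..1} (green (h k))) \<longlonglongrightarrow> integral {0..1} (green g)"
  proof (rule dominated_convergence(2))
    show "green (h k) integrable_on {0..1}" for k
      by (intro integrable_continuous_real green_continuous[OF h])
    show "norm (green (h k) t) \<le> m" if "t \<in> {0..1}" for k t
      using green_nonneg[OF h that] green_le_1[OF h that] green_1_le[OF h] by (smt (verit) real_norm_def)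
  qed (auto simp: G)
  then show ?thesis
    unfolding solve_def average_def using mass_less_1 eta by (intro tendsto_intros G t) auto
qed

context
  fixes h :: "real \<Rightarrow> real" and m :: real
  assumes h: "continuous_on {0..1} h" "\<And>s. s \<in> {0..1} \<Longrightarrow> 0 \<le> h s \<and> h s \<le> m"
begin

lemma average_green: "0 \<le> average (green h)" "average (green h) \<le> mass * green h 1"
  using average_mono[of "\<lambda>_. 0" "green h"] average_mono[of "green h" "\<lambda>_. green h 1"]
    green_nonneg[OF h] green_le_1[OF h] green_continuous[OF h]
  by (auto simp: average_const)

lemma solve_mono_Lipschitz:
  assumes "0 \<le> s" "s \<le> t" "t \<le> 1"
  shows "solve h s \<le> solve h t" "solve h t - solve h s \<le> m * (t - s)"
  using green_mono_Lipschitz[OF h assms] by (auto simp: solve_def)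

lemma solve_nonneg: "t \<in> {0..1} \<Longrightarrow> 0 \<le> solve h t"
  using green_nonneg[OF h] average_green mass_less_1 by (simp add: solve_def)

lemma solve_le_1: "t \<in> {0..1} \<Longrightarrow> solve h t \<le> solve h 1"
  using solve_mono_Lipschitz(1)[of t 1] by simp

text \<open>
  The additive constant is nonnegative, so the cubic bound for the Green operator survives.
\<close>
lemma solve_cubic:
  assumes t: "t \<in> {0..1}"
  shows "t ^ 3 * solve h 1 \<le> solve h t"
proof -
  have "t ^ 3 * (average (green h) / (1 - mass)) \<le> average (green h) / (1 - mass)"
    using t average_green mass_less_1 by (intro mult_left_le_one_le power_le_one) auto
  then show ?thesis using green_cubic[OF h t] by (simp add: solve_def distrib_left)
qed

lemma solve_1_le: "solve h 1 \<le> m / (1 - mass)"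
proof -
  have "solve h 1 \<le> green h 1 + mass * green h 1 / (1 - mass)"
    using average_green mass_less_1 by (simp add: solve_def divide_right_mono)
  also have "\<dots> = green h 1 / (1 - mass)" using mass_less_1 by (simp add: field_simps)
  also have "\<dots> \<le> m / (1 - mass)" using green_1_le[OF h] mass_less_1 by (simp add: divide_right_mono)
  finally show ?thesis .
qed

lemma solve_1_ge:
  assumes "\<And>s. s \<in> {1/2..3/4} \<Longrightarrow> b \<le> h s" "0 \<le> b"
  shows "b / 768 \<le> solve h 1"
proof -
  have "0 \<le> average (green h) / (1 - mass)" using average_green mass_less_1 by simp
  then show ?thesis using green_1_ge[OF h assms] unfolding solve_def by linarith
qed

end

end

section \<open>Radial fixed points of the superposition operator\<close>

lemma continuous_on_superposition:
  fixes f :: "real \<Rightarrow> real \<Rightarrow> real"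
  assumes f: "continuous_on ({0..1} \<times> {0..}) (\<lambda>(t, u). f t u)"
    and u: "continuous_on {0..1} u" "\<And>s. s \<in> {0..1} \<Longrightarrow> 0 \<le> u s"
  shows "continuous_on {0..1} (\<lambda>s. f s (u s))"
proof -
  have "continuous_on {0..1} (\<lambda>s. (\<lambda>(t, u). f t u) (s, u s))"
    by (rule continuous_on_compose2[OF f]) (use u in \<open>auto intro!: continuous_intros\<close>)
  then show ?thesis by simp
qed

lemma bounded_on_strip:
  fixes f :: "real \<Rightarrow> real \<Rightarrow> real"
  assumes f: "continuous_on ({0..1} \<times> {0..}) (\<lambda>(t, u). f t u)"
  obtains m where "0 < m" "\<And>t x. t \<in> {0..1} \<Longrightarrow> x \<in> {0..R} \<Longrightarrow> f t x \<le> m"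
proof -
  have "compact ((\<lambda>(t, u). f t u) ` ({0..1} \<times> {0..R}))"
    by (intro compact_continuous_image continuous_on_subset[OF f] compact_Times) auto
  then obtain m where m: "\<And>y. y \<in> (\<lambda>(t, u). f t u) ` ({0..1} \<times> {0..R}) \<Longrightarrow> norm y \<le> m"
    using compact_imp_bounded bounded_iff by metis
  have "f t x \<le> \<bar>m\<bar> + 1" if "t \<in> {0..1}" "x \<in> {0..R}" for t x
    using m[of "f t x"] that by force
  then show thesis by (intro that[of "\<bar>m\<bar> + 1"]) auto
qed

context nonlocal_condition
begin

text \<open>
  The map \<open>A\<close> below treats the radius \<open>\<rho> = u(1)\<close> and the profile of \<open>u\<close> separately.  The sign of
  \<open>\<sigma>\<close> decides whether the hypotheses describe a compression or an expansion of the cone; the radius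
  equation \<open>(T h)(1) = \<rho>\<close> is the same for both.
\<close>
lemma radial_fixed_point:
  fixes f :: "real \<Rightarrow> real \<Rightarrow> real" and r0 R \<sigma> :: real
  assumes f: "continuous_on ({0..1} \<times> {0..}) (\<lambda>(t, u). f t u)"
    and f0: "\<And>t u. t \<in> {0..1} \<Longrightarrow> u \<ge> 0 \<Longrightarrow> f t u \<ge> 0"
    and r: "0 < r0" "r0 < R" and \<sigma>: "\<sigma> \<noteq> 0"
    and inner: "\<And>u. continuous_on {0..1} u \<Longrightarrow> (\<And>t. t \<in> {0..1} \<Longrightarrow> r0 * t ^ 3 \<le> u t \<and> u t \<le> r0) \<Longrightarrow>
         0 \<le> \<sigma> * (solve (\<lambda>s. f s (u s)) 1 - r0)"
    and outer: "\<And>u. continuous_on {0..1} u \<Longrightarrow> (\<And>t. t \<in> {0..1} \<Longrightarrow> R * t ^ 3 \<le> u t \<and> u t \<le> R) \<Longrightarrow>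
         \<sigma> * (solve (\<lambda>s. f s (u s)) 1 - R) \<le> 0"
  shows "\<exists>u \<rho>. 0 < \<rho> \<and> continuous_on {0..1} u \<and>
     (\<forall>t\<in>{0..1}. \<rho> * t ^ 3 \<le> u t \<and> u t \<le> \<rho> \<and> u t = solve (\<lambda>s. f s (u s)) t)"
proof -
  define cl where "cl = (\<lambda>a b x :: real. max a (min b x))"
  \<comment> \<open>The inner cut-off in \<open>H\<close> makes \<open>A\<close> defined for every continuous \<open>u\<close>; it is inactive
    at a fixed point, which lies between \<open>\<rho> t\<^sup>3\<close> and \<open>\<rho>\<close>.\<close>
  define \<rho> where "\<rho> = (\<lambda>u :: real \<Rightarrow> real. cl r0 R (u 1))"
  define H where "H = (\<lambda>u s. f s (cl (\<rho> u * s ^ 3) (\<rho> u) (u s)))"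
  define y where "y = (\<lambda>u. solve (H u))"
  define q where "q = (\<lambda>u. cl r0 R (\<rho> u + \<sigma> * (y u 1 - \<rho> u)))"
  \<comment> \<open>The profile of \<open>y\<close> cannot be normalised if \<open>y = 0\<close>.  Adding the constant
    \<open>max 0 (\<rho> - y 1)\<close> makes the value at \<open>1\<close> equal to \<open>max \<rho> (y 1) > 0\<close>, and the constant vanishes
    once the radius equation \<open>y 1 = \<rho>\<close> holds.\<close>
  define A where "A = (\<lambda>u t. q u * ((y u t + max 0 (\<rho> u - y u 1)) / max (\<rho> u) (y u 1)))"
  obtain m where m: "0 < m" "\<And>t x. t \<in> {0..1} \<Longrightarrow> x \<in> {0..R} \<Longrightarrow> f t x \<le> m"
    using bounded_on_strip[OF f] by blast
  have cl_in: "a \<le> cl a b x \<and> cl a b x \<le> b" if "a \<le> b" for a b x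
    using that by (auto simp: cl_def)
  have \<rho>: "r0 \<le> \<rho> u \<and> \<rho> u \<le> R" and q: "r0 \<le> q u \<and> q u \<le> R" for u
    using r cl_in by (auto simp: \<rho>_def q_def)
  have cube: "0 \<le> \<rho> u * s ^ 3 \<and> \<rho> u * s ^ 3 \<le> \<rho> u" if "s \<in> {0..1}" for u and s :: real
    using that \<rho>[of u] r by (auto intro!: mult_left_le power_le_one)
  have cl0: "0 \<le> cl (\<rho> u * s ^ 3) (\<rho> u) (u s)" "cl (\<rho> u * s ^ 3) (\<rho> u) (u s) \<le> R"
    if "s \<in> {0..1}" for u s
    using cl_in[of "\<rho> u * s ^ 3" "\<rho> u" "u s"] cube[OF that, of u] \<rho>[of u] by linarith+
  have H: "continuous_on {0..1} (H u)" "\<And>s. s \<in> {0..1} \<Longrightarrow> 0 \<le> H u s \<and> H u s \<le> m"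
    if "continuous_on {0..1} u" for u
  proof -
    show "continuous_on {0..1} (H u)"
      unfolding H_def using that
      by (intro continuous_on_superposition[OF f] cl0) (auto simp: cl_def intro!: continuous_intros)
    show "\<And>s. s \<in> {0..1} \<Longrightarrow> 0 \<le> H u s \<and> H u s \<le> m"
      using f0 m(2) cl0 by (auto simp: H_def)
  qed
  have den: "0 < max (\<rho> u) (y u 1)" for u using \<rho>[of u] r by auto
  have y: "0 \<le> y u t" "y u t \<le> y u 1" "t ^ 3 * y u 1 \<le> y u t"
    if "continuous_on {0..1} u" "t \<in> {0..1}" for u t
    using solve_nonneg[OF H[OF that(1)] that(2)] solve_le_1[OF H[OF that(1)] that(2)]
      solve_cubic[OF H[OF that(1)] that(2)] by (auto simp: y_def)
  have frac: "t ^ 3 \<le> (y u t + max 0 (\<rho> u - y u 1)) / max (\<rho> u) (y u 1)"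
    "(y u t + max 0 (\<rho> u - y u 1)) / max (\<rho> u) (y u 1) \<le> 1"
    if "continuous_on {0..1} u" "t \<in> {0..1}" for u t
  proof -
    have "t ^ 3 * max 0 (\<rho> u - y u 1) \<le> max 0 (\<rho> u - y u 1)"
      using that(2) by (intro mult_left_le_one_le power_le_one) auto
    moreover have *: "max (\<rho> u) (y u 1) = y u 1 + max 0 (\<rho> u - y u 1)" by simp
    ultimately have "t ^ 3 * max (\<rho> u) (y u 1) \<le> y u t + max 0 (\<rho> u - y u 1)"
      using y(3)[OF that] unfolding * distrib_left by linarith
    then show "t ^ 3 \<le> (y u t + max 0 (\<rho> u - y u 1)) / max (\<rho> u) (y u 1)"
      using den by (subst pos_le_divide_eq) auto
    show "(y u t + max 0 (\<rho> u - y u 1)) / max (\<rho> u) (y u 1) \<le> 1"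
      using den[of u] y(2)[OF that] * by (subst pos_divide_le_eq) auto
  qed
  have "\<exists>u. continuous_on {0..1} u \<and> (\<forall>t\<in>{0..1}. A u t = u t)"
  proof (rule schauder_equi_Lipschitz)
    show "0 < R" using r by simp
    fix u :: "real \<Rightarrow> real" assume u: "continuous_on {0..1} u"
    fix t :: real assume t: "t \<in> {0..1}"
    let ?w = "(y u t + max 0 (\<rho> u - y u 1)) / max (\<rho> u) (y u 1)"
    have w0: "0 \<le> ?w"
      using frac(1)[OF u t] t by (meson atLeastAtMost_iff order_trans zero_le_power)
    have "q u * ?w \<le> R * 1" using frac(2)[OF u t] q[of u] r w0 by (intro mult_mono) auto
    moreover have "0 \<le> q u * ?w" using q[of u] r w0 by (intro mult_nonneg_nonneg) auto
    ultimately show "A u t \<in> {0..R}" unfolding A_def by simp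
    fix s :: real assume s: "s \<in> {0..1}"
    have "\<bar>y u s - y u t\<bar> \<le> m * \<bar>s - t\<bar>"
    proof (cases s t rule: linorder_le_cases)
      case le
      then show ?thesis using solve_mono_Lipschitz[OF H[OF u], of s t] s t by (auto simp: y_def)
    next
      case ge
      then show ?thesis using solve_mono_Lipschitz[OF H[OF u], of t s] s t by (auto simp: y_def)
    qed
    moreover have "q u / max (\<rho> u) (y u 1) \<le> R / r0"
      using q[of u] \<rho>[of u] r by (intro frac_le) auto
    moreover have "0 \<le> q u / max (\<rho> u) (y u 1)" using q[of u] r den[of u] by auto
    moreover have "A u s - A u t = q u / max (\<rho> u) (y u 1) * (y u s - y u t)"
      by (simp add: A_def algebra_simps diff_divide_distrib add_divide_distrib)
    ultimately show "\<bar>A u s - A u t\<bar> \<le> (R / r0 * m) * \<bar>s - t\<bar>"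
      using mult_mono[of "q u / max (\<rho> u) (y u 1)" "R / r0" "\<bar>y u s - y u t\<bar>" "m * \<bar>s - t\<bar>"] r
      by (simp only: abs_mult abs_of_nonneg mult.assoc)
  next
    fix v :: "nat \<Rightarrow> real \<Rightarrow> real" and u t
    assume v: "\<And>k. continuous_on {0..1} (v k)" and u: "continuous_on {0..1} u"
      and "uniform_limit {0..1} v u sequentially" and t: "t \<in> {0..1::real}"
    then have lim: "(\<lambda>k. v k s) \<longlonglongrightarrow> u s" if "s \<in> {0..1}" for s
      using tendsto_uniform_limitI that by metis
    have l\<rho>: "(\<lambda>k. \<rho> (v k)) \<longlonglongrightarrow> \<rho> u"
      unfolding \<rho>_def cl_def by (intro tendsto_intros lim) auto
    have lH: "(\<lambda>k. H (v k) s) \<longlonglongrightarrow> H u s" if s: "s \<in> {0..1}" for s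
    proof -
      have *: "(\<lambda>k. (s, cl (\<rho> (v k) * s ^ 3) (\<rho> (v k)) (v k s)))
          \<longlonglongrightarrow> (s, cl (\<rho> u * s ^ 3) (\<rho> u) (u s))"
        unfolding cl_def by (intro tendsto_intros l\<rho> lim s)
      have "(\<lambda>k. (\<lambda>(t, u). f t u) (s, cl (\<rho> (v k) * s ^ 3) (\<rho> (v k)) (v k s)))
          \<longlonglongrightarrow> (\<lambda>(t, u). f t u) (s, cl (\<rho> u * s ^ 3) (\<rho> u) (u s))"
        by (rule continuous_on_tendsto_compose[OF f *]) (use s cl0 in auto)
      then show ?thesis by (simp add: H_def)
    qed
    have ly: "(\<lambda>k. y (v k) s) \<longlonglongrightarrow> y u s" if "s \<in> {0..1}" for s
      unfolding y_def by (rule solve_tendsto[OF H[OF v] lH that])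
    have "(\<lambda>k. q (v k)) \<longlonglongrightarrow> q u"
      unfolding q_def cl_def by (intro tendsto_intros l\<rho> ly) auto
    then show "(\<lambda>k. A (v k) t) \<longlonglongrightarrow> A u t"
      unfolding A_def using den[of u] by (intro tendsto_intros l\<rho> ly t) auto
  qed
  then obtain u where u: "continuous_on {0..1} u" and fix_u: "\<And>t. t \<in> {0..1} \<Longrightarrow> A u t = u t" by blast
  have "A u 1 = q u" using den[of u] by (auto simp: A_def max_def)
  then have u1: "u 1 = q u" using fix_u[of 1] by simp
  have \<rho>q: "\<rho> u = q u" using q[of u] by (simp add: \<rho>_def cl_def u1)
  have between: "\<rho> u * t ^ 3 \<le> u t \<and> u t \<le> \<rho> u" if t: "t \<in> {0..1}" for t
    using mult_left_mono[OF frac(1)[OF u t], of "q u"] mult_left_mono[OF frac(2)[OF u t], of "q u"]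
      fix_u[OF t] q[of u] r by (simp add: A_def \<rho>q)
  have y_eq: "y u t = solve (\<lambda>s. f s (u s)) t" if "t \<in> {0..1}" for t
    unfolding y_def
  proof (rule solve_cong[OF _ that])
    show "H u s = f s (u s)" if "s \<in> {0..1}" for s
      using between[OF that] by (simp add: H_def cl_def)
  qed
  have eq: "\<rho> u = cl r0 R (\<rho> u + \<sigma> * (y u 1 - \<rho> u))" by (subst \<rho>q) (simp only: q_def)
  \<comment> \<open>If the radius were moved, it would be cut off back to itself, which is possible only at
    \<open>r0\<close> moving down or at \<open>R\<close> moving up; both are excluded by hypothesis.\<close>
  have "\<sigma> * (y u 1 - \<rho> u) = 0"
  proof (rule ccontr)
    assume "\<sigma> * (y u 1 - \<rho> u) \<noteq> 0"
    then consider "\<sigma> * (y u 1 - \<rho> u) < 0" | "\<sigma> * (y u 1 - \<rho> u) > 0" by linarith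
    then show False
    proof cases
      case 1
      then have "\<rho> u = r0" using eq \<rho>[of u] by (auto simp: cl_def max_def min_def split: if_splits)
      then show False using inner[OF u] between 1 y_eq[of 1] by simp
    next
      case 2
      then have "\<rho> u = R" using eq \<rho>[of u] by (auto simp: cl_def max_def min_def split: if_splits)
      then show False using outer[OF u] between 2 y_eq[of 1] by simp
    qed
  qed
  then have y1: "y u 1 = \<rho> u" using \<sigma> by simp
  have "u t = y u t" if t: "t \<in> {0..1}" for t
    using fix_u[OF t] \<rho>[of u] r by (simp add: A_def y1 \<rho>q)
  then show ?thesis using between y_eq u \<rho>[of u] r by (intro exI[of _ u] exI[of _ "\<rho> u"]) auto
qed

end

section \<open>Growth of the nonlinearity\<close>

text \<open>
  Stated for an arbitrary filter because it is used both near \<open>0\<close> and at infinity.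
\<close>
lemma eventually_above_line:
  fixes f :: "real \<Rightarrow> real \<Rightarrow> real"
  assumes f0: "\<And>t x. t \<in> {0..1} \<Longrightarrow> x \<ge> 0 \<Longrightarrow> f t x \<ge> 0"
    and lim: "((\<lambda>u. ereal (ratio_min f u)) \<longlongrightarrow> \<infinity>) F" and pos: "eventually (\<lambda>x. x > 0) F"
  shows "eventually (\<lambda>x. \<forall>t\<in>{0..1}. M * x \<le> f t x) F"
proof -
  have "eventually (\<lambda>x. ereal M < ereal (ratio_min f x)) F"
    using order_tendstoD(1)[OF lim, of "ereal M"] by simp
  with pos show ?thesis
  proof eventually_elim
    case (elim x)
    have "M * x \<le> f t x" if t: "t \<in> {0..1}" for t
    proof -
      have "bdd_below ((\<lambda>t. f t x / x) ` {0..1})"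
        using f0 elim(1) by (intro bdd_belowI[of _ 0]) auto
      then have "ratio_min f x \<le> f t x / x"
        unfolding ratio_min_def by (rule cINF_lower[OF _ t])
      then have "M \<le> f t x / x" using elim(2) by simp
      then show ?thesis using elim(1) by (simp add: field_simps)
    qed
    then show ?case by blast
  qed
qed

lemma eventually_below_line:
  fixes f :: "real \<Rightarrow> real \<Rightarrow> real"
  assumes f: "continuous_on ({0..1} \<times> {0..}) (\<lambda>(t, u). f t u)"
    and lim: "((\<lambda>u. ereal (ratio_max f u)) \<longlongrightarrow> 0) F" and pos: "eventually (\<lambda>x. x > 0) F"
    and e: "e > 0"
  shows "eventually (\<lambda>x. \<forall>t\<in>{0..1}. f t x \<le> e * x) F"
proof -
  have "eventually (\<lambda>x. ereal (ratio_max f x) < ereal e) F"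
    using order_tendstoD(2)[OF lim, of "ereal e"] e by simp
  with pos show ?thesis
  proof eventually_elim
    case (elim x)
    obtain m where m: "\<And>t y. t \<in> {0..1} \<Longrightarrow> y \<in> {0..x} \<Longrightarrow> f t y \<le> m"
      using bounded_on_strip[OF f] by metis
    have "f t x \<le> e * x" if t: "t \<in> {0..1}" for t
    proof -
      have "bdd_above ((\<lambda>t. f t x / x) ` {0..1})"
        using m[of _ x] elim(1) by (intro bdd_aboveI[of _ "m / x"]) (auto intro!: divide_right_mono)
      then have "f t x / x \<le> ratio_max f x"
        unfolding ratio_max_def by (rule cSUP_upper[OF t])
      then have "f t x / x \<le> e" using elim(2) by simp
      then show ?thesis using elim(1) by (simp add: field_simps)
    qed
    then show ?case by blast
  qed
qed

section \<open>Existence of positive solutions\<close>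

context nonlocal_condition
begin

context
  fixes f :: "real \<Rightarrow> real \<Rightarrow> real"
  assumes f: "continuous_on ({0..1} \<times> {0..}) (\<lambda>(t, u). f t u)"
    and f0: "\<And>t x. t \<in> {0..1} \<Longrightarrow> x \<ge> 0 \<Longrightarrow> f t x \<ge> 0"
begin

lemma radial_le:
  assumes u: "continuous_on {0..1} u" "\<And>t. t \<in> {0..1} \<Longrightarrow> \<rho> * t ^ 3 \<le> u t \<and> u t \<le> \<rho>" and "0 < \<rho>"
    and small: "\<And>t x. t \<in> {0..1} \<Longrightarrow> x \<in> {0..\<rho>} \<Longrightarrow> f t x \<le> (1 - mass) * \<rho>"
  shows "solve (\<lambda>s. f s (u s)) 1 \<le> \<rho>"
proof -
  have u0: "0 \<le> u s" if "s \<in> {0..1}" for s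
    by (rule order_trans[of 0 "\<rho> * s ^ 3"]) (use u(2)[OF that] \<open>0 < \<rho>\<close> that in auto)
  have "solve (\<lambda>s. f s (u s)) 1 \<le> (1 - mass) * \<rho> / (1 - mass)"
    using u0 u(2) f0 small by (intro solve_1_le continuous_on_superposition[OF f u(1)]) auto
  then show ?thesis using mass_less_1 by simp
qed

text \<open>
  On \<open>[1/2, 3/4]\<close> the lower bound \<open>\<rho> t\<^sup>3\<close> is at least \<open>\<rho>/8\<close>, so \<open>u\<close> cannot leave the range in which
  \<open>f\<close> is large; the slope is \<open>6144 = 8 * 768\<close>, with \<open>768\<close> from the lower bound for \<open>solve\<close>.
\<close>
lemma radial_ge:
  assumes u: "continuous_on {0..1} u" "\<And>t. t \<in> {0..1} \<Longrightarrow> \<rho> * t ^ 3 \<le> u t \<and> u t \<le> \<rho>" and "0 < \<rho>"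
    and large: "\<And>t x. t \<in> {0..1} \<Longrightarrow> x \<in> {\<rho> / 8..\<rho>} \<Longrightarrow> 6144 * x \<le> f t x"
  shows "\<rho> \<le> solve (\<lambda>s. f s (u s)) 1"
proof -
  have u0: "0 \<le> u s" if "s \<in> {0..1}" for s
    by (rule order_trans[of 0 "\<rho> * s ^ 3"]) (use u(2)[OF that] \<open>0 < \<rho>\<close> that in auto)
  obtain m where m: "\<And>t x. t \<in> {0..1} \<Longrightarrow> x \<in> {0..\<rho>} \<Longrightarrow> f t x \<le> m"
    using bounded_on_strip[OF f] by metis
  have "768 * \<rho> \<le> f s (u s)" if s: "s \<in> {1/2..3/4}" for s
  proof -
    have "(1/2) ^ 3 \<le> s ^ 3" using s by (intro power_mono) auto
    then have "\<rho> * (1/8) \<le> \<rho> * s ^ 3" using \<open>0 < \<rho>\<close> by (intro mult_left_mono) (auto simp: power_divide)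
    moreover have s1: "s \<in> {0..1}" using s by simp
    ultimately have u8: "u s \<in> {\<rho> / 8..\<rho>}" using u(2)[OF s1] by simp
    then have "768 * \<rho> \<le> 6144 * u s" by simp
    with large[OF s1 u8] show ?thesis by linarith
  qed
  then have "(768 * \<rho>) / 768 \<le> solve (\<lambda>s. f s (u s)) 1"
    using u0 u(2) f0 m \<open>0 < \<rho>\<close>
    by (intro solve_1_ge[where m = m] continuous_on_superposition[OF f u(1)]) auto
  then show ?thesis by simp
qed

lemma sublinear_fixed_point:
  assumes zero: "((\<lambda>u. ereal (ratio_min f u)) \<longlongrightarrow> \<infinity>) (at_right 0)"
    and infty: "((\<lambda>u. ereal (ratio_max f u)) \<longlongrightarrow> 0) at_top"
  shows "\<exists>u \<rho>. 0 < \<rho> \<and> continuous_on {0..1} u \<and>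
     (\<forall>t\<in>{0..1}. \<rho> * t ^ 3 \<le> u t \<and> u t \<le> \<rho> \<and> u t = solve (\<lambda>s. f s (u s)) t)"
proof -
  have "eventually (\<lambda>x. \<forall>t\<in>{0..1}. 6144 * x \<le> f t x) (at_right 0)"
    using eventually_above_line[OF f0 zero eventually_at_right_less] .
  then obtain \<delta> where \<delta>: "\<delta> > 0" "\<And>t x. 0 < x \<Longrightarrow> x < \<delta> \<Longrightarrow> t \<in> {0..1} \<Longrightarrow> 6144 * x \<le> f t x"
    unfolding eventually_at_right_field by blast
  have "eventually (\<lambda>x. \<forall>t\<in>{0..1}. f t x \<le> (1 - mass) * x) at_top"
    using eventually_below_line[OF f infty eventually_gt_at_top] mass_less_1 by simp
  then obtain X where X: "\<And>t x. X \<le> x \<Longrightarrow> t \<in> {0..1} \<Longrightarrow> f t x \<le> (1 - mass) * x"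
    unfolding eventually_at_top_linorder by blast
  obtain m where m: "\<And>t x. t \<in> {0..1} \<Longrightarrow> x \<in> {0..X} \<Longrightarrow> f t x \<le> m"
    using bounded_on_strip[OF f] by metis
  \<comment> \<open>The growth hypothesis at infinity controls \<open>f\<close> above \<open>X\<close> only; the term \<open>m / (1 - mass)\<close>
    accounts for the range \<open>[0, X]\<close>.\<close>
  define R where "R = max \<delta> (m / (1 - mass))"
  have R: "\<delta> \<le> R" "m \<le> (1 - mass) * R"
    using mass_less_1 by (auto simp: R_def max_def field_simps)
  show ?thesis
  proof (rule radial_fixed_point[OF f f0, where \<sigma> = 1 and ?r0.0 = "\<delta> / 2" and R = R])
    fix u assume "continuous_on {0..1} u" "\<And>t. t \<in> {0..1} \<Longrightarrow> \<delta> / 2 * t ^ 3 \<le> u t \<and> u t \<le> \<delta> / 2"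
    then have "\<delta> / 2 \<le> solve (\<lambda>s. f s (u s)) 1"
      using \<delta> by (intro radial_ge) auto
    then show "0 \<le> 1 * (solve (\<lambda>s. f s (u s)) 1 - \<delta> / 2)" by simp
  next
    fix u assume u: "continuous_on {0..1} u" "\<And>t. t \<in> {0..1} \<Longrightarrow> R * t ^ 3 \<le> u t \<and> u t \<le> R"
    have "solve (\<lambda>s. f s (u s)) 1 \<le> R"
    proof (rule radial_le[OF u])
      fix t x :: real assume t: "t \<in> {0..1}" and x: "x \<in> {0..R}"
      show "f t x \<le> (1 - mass) * R"
      proof (cases "X \<le> x")
        case True
        have "(1 - mass) * x \<le> (1 - mass) * R" using x mass_less_1 by (intro mult_left_mono) auto
        then show ?thesis using X[OF True t] by linarith
      next
        case False
        then show ?thesis using m[OF t, of x] x R(2) by auto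
      qed
    qed (use R \<delta> in auto)
    then show "1 * (solve (\<lambda>s. f s (u s)) 1 - R) \<le> 0" by simp
  qed (use R \<delta> in auto)
qed

lemma superlinear_fixed_point:
  assumes zero: "((\<lambda>u. ereal (ratio_max f u)) \<longlongrightarrow> 0) (at_right 0)"
    and infty: "((\<lambda>u. ereal (ratio_min f u)) \<longlongrightarrow> \<infinity>) at_top"
  shows "\<exists>u \<rho>. 0 < \<rho> \<and> continuous_on {0..1} u \<and>
     (\<forall>t\<in>{0..1}. \<rho> * t ^ 3 \<le> u t \<and> u t \<le> \<rho> \<and> u t = solve (\<lambda>s. f s (u s)) t)"
proof -
  have "eventually (\<lambda>x. \<forall>t\<in>{0..1}. f t x \<le> (1 - mass) * x) (at_right 0)"
    using eventually_below_line[OF f zero eventually_at_right_less] mass_less_1 by simp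
  then obtain \<delta> where \<delta>: "\<delta> > 0" "\<And>t x. 0 < x \<Longrightarrow> x < \<delta> \<Longrightarrow> t \<in> {0..1} \<Longrightarrow> f t x \<le> (1 - mass) * x"
    unfolding eventually_at_right_field by blast
  have "eventually (\<lambda>x. \<forall>t\<in>{0..1}. 6144 * x \<le> f t x) at_top"
    using eventually_above_line[OF f0 infty eventually_gt_at_top] .
  then obtain X where X: "\<And>t x. X \<le> x \<Longrightarrow> t \<in> {0..1} \<Longrightarrow> 6144 * x \<le> f t x"
    unfolding eventually_at_top_linorder by blast
  \<comment> \<open>Functions of radius \<open>R\<close> are at least \<open>R / 8 \<ge> X\<close> where \<open>radial_ge\<close> uses them.\<close>
  define R where "R = max \<delta> (8 * X)"
  have R: "\<delta> \<le> R" "X \<le> R / 8" by (auto simp: R_def)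
  show ?thesis
  proof (rule radial_fixed_point[OF f f0, where \<sigma> = "-1" and ?r0.0 = "\<delta> / 2" and R = R])
    fix u assume u: "continuous_on {0..1} u" "\<And>t. t \<in> {0..1} \<Longrightarrow> \<delta> / 2 * t ^ 3 \<le> u t \<and> u t \<le> \<delta> / 2"
    \<comment> \<open>The limit at \<open>0\<close> says nothing about the value \<open>x = 0\<close>, which \<open>u\<close> may take at \<open>t = 0\<close>;
      that case is recovered below by continuity.\<close>
    have pos: "f t x \<le> (1 - mass) * (\<delta> / 2)" if "t \<in> {0..1}" "0 < x" "x \<le> \<delta> / 2" for t x
    proof -
      have "(1 - mass) * x \<le> (1 - mass) * (\<delta> / 2)" using that mass_less_1 by (intro mult_left_mono) auto
      then show ?thesis using \<delta>(2)[of x t] that \<delta>(1) by linarith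
    qed
    have "solve (\<lambda>s. f s (u s)) 1 \<le> \<delta> / 2"
    proof (rule radial_le[OF u])
      fix t x :: real assume t: "t \<in> {0..1}" and x: "x \<in> {0..\<delta> / 2}"
      show "f t x \<le> (1 - mass) * (\<delta> / 2)"
      proof (cases "x = 0")
        case True
        have "(\<lambda>k. (\<lambda>(t, u). f t u) (t, \<delta> / 2 * inverse (real (Suc k)))) \<longlonglongrightarrow> (\<lambda>(t, u). f t u) (t, 0)"
        proof (rule continuous_on_tendsto_compose[OF f])
          have "(\<lambda>k. \<delta> / 2 * inverse (real (Suc k))) \<longlonglongrightarrow> \<delta> / 2 * 0"
            by (intro tendsto_intros LIMSEQ_inverse_real_of_nat)
          then show "(\<lambda>k. (t, \<delta> / 2 * inverse (real (Suc k)))) \<longlonglongrightarrow> (t, 0)"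
            by (intro tendsto_Pair) auto
        qed (use t \<delta>(1) in auto)
        then have "(\<lambda>k. f t (\<delta> / 2 * inverse (real (Suc k)))) \<longlonglongrightarrow> f t 0" by simp
        moreover have "f t (\<delta> / 2 * inverse (real (Suc k))) \<le> (1 - mass) * (\<delta> / 2)" for k
          using t \<delta>(1) by (intro pos mult_left_le) (auto simp: inverse_le_1_iff)
        ultimately show ?thesis unfolding True by (intro LIMSEQ_le_const2) auto
      qed (use pos t x in auto)
    qed (use \<delta> in auto)
    then show "0 \<le> -1 * (solve (\<lambda>s. f s (u s)) 1 - \<delta> / 2)" by simp
  next
    fix u assume u: "continuous_on {0..1} u" "\<And>t. t \<in> {0..1} \<Longrightarrow> R * t ^ 3 \<le> u t \<and> u t \<le> R"
    have "R \<le> solve (\<lambda>s. f s (u s)) 1"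
      using u R \<delta>(1) X by (intro radial_ge) auto
    then show "-1 * (solve (\<lambda>s. f s (u s)) 1 - R) \<le> 0" by simp
  qed (use R \<delta> in auto)
qed

text \<open>
  The solution is taken to be \<open>solve h\<close> rather than \<open>u\<close> itself: the two agree on \<open>[0,1]\<close>, and the
  regularity of \<open>solve h\<close> is explicit.
\<close>
lemma fixed_point_solves:
  assumes rho: "0 < \<rho>" and u: "continuous_on {0..1} u"
    and bd: "\<And>t. t \<in> {0..1} \<Longrightarrow> \<rho> * t ^ 3 \<le> u t \<and> u t \<le> \<rho>"
    and fix_u: "\<And>t. t \<in> {0..1} \<Longrightarrow> u t = solve (\<lambda>s. f s (u s)) t"
    and \<theta>: "0 < \<theta>" "\<theta> < 1/2"
  shows "solve (\<lambda>s. f s (u s)) \<in> cone_K \<theta>"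
    "positive_bvp_solution f \<alpha> n \<beta> \<eta> (solve (\<lambda>s. f s (u s)))"
proof -
  define h where "h = (\<lambda>s. f s (u s))"
  define w where "w = solve h"
  have u0: "0 \<le> u s" if "s \<in> {0..1}" for s
    by (rule order_trans[of 0 "\<rho> * s ^ 3"]) (use bd[OF that] rho that in auto)
  obtain m where m: "\<And>t x. t \<in> {0..1} \<Longrightarrow> x \<in> {0..\<rho>} \<Longrightarrow> f t x \<le> m"
    using bounded_on_strip[OF f] by metis
  have h: "continuous_on {0..1} h" "\<And>s. s \<in> {0..1} \<Longrightarrow> 0 \<le> h s \<and> h s \<le> m"
    using continuous_on_superposition[OF f u u0] f0 u0 m bd by (auto simp: h_def)
  have wu: "w t = u t" if "t \<in> {0..1}" for t using fix_u[OF that] by (simp add: w_def h_def)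
  have w_def': "w = (\<lambda>t. green h t + average (green h) / (1 - mass))" by (auto simp: w_def solve_def)
  note C4 = green_shift_C4[OF h(1), where c = "average (green h) / (1 - mass)", folded w_def']
  have "deriv01 4 w t + f t (w t) = 0" if "t \<in> {0<..<1}" for t
  proof -
    have "t \<in> {0..1}" using that by simp
    from C4(2)[OF this] wu[OF this] show ?thesis by (simp add: h_def)
  qed
  moreover have "w 0 = \<alpha> * integral {0..1} w + (\<Sum>i=1..n. \<beta> i * w (\<eta> i))"
    using solve_boundary[OF h] by (simp add: w_def average_def)
  moreover have "0 < w t" if "t \<in> {0<..<1}" for t
  proof -
    have "0 < \<rho> * t ^ 3" using that rho by simp
    then show ?thesis using bd[of t] wu[of t] that by simp
  qed
  ultimately show "positive_bvp_solution f \<alpha> n \<beta> \<eta> (solve (\<lambda>s. f s (u s)))"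
    using C4 unfolding positive_bvp_solution_def bvp_solution_def h_def[symmetric] w_def[symmetric] by blast
  have norm: "sup_norm w \<le> w 1"
    unfolding sup_norm_def w_def using solve_nonneg[OF h] solve_le_1[OF h] by (intro cSUP_least) auto
  have "\<theta> ^ 3 * (1 - 2 * \<theta>) * sup_norm w \<le> w t" if t: "t \<in> {\<theta>..1 - \<theta>}" for t
  proof -
    have t1: "t \<in> {0..1}" using t \<theta> by auto
    have w1: "0 \<le> w 1" using solve_nonneg[OF h, of 1] by (simp add: w_def)
    have "\<theta> ^ 3 * (1 - 2 * \<theta>) * sup_norm w \<le> \<theta> ^ 3 * (1 - 2 * \<theta>) * w 1"
      using norm \<theta> by (intro mult_left_mono) auto
    also have "\<dots> \<le> t ^ 3 * 1 * w 1"
      using t \<theta> w1 by (intro mult_right_mono mult_mono power_mono) auto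
    also have "\<dots> \<le> w t" using solve_cubic[OF h t1] by (simp add: w_def)
    finally show ?thesis .
  qed
  then have "\<theta> ^ 3 * (1 - 2 * \<theta>) * sup_norm w \<le> (INF t\<in>{\<theta>..1 - \<theta>}. w t)"
    using \<theta> by (intro cINF_greatest) auto
  moreover have "continuous_on {0..1} w"
    using continuous_on_cong[of "{0..1}" "{0..1}" w u] wu u by simp
  moreover have "\<forall>t\<in>{0..1}. 0 \<le> w t" using wu u0 by simp
  ultimately show "solve (\<lambda>s. f s (u s)) \<in> cone_K \<theta>"
    unfolding cone_K_def h_def[symmetric] w_def[symmetric] by simp
qed

end
end

theorem theorem3p1:
  fixes f :: "real \<Rightarrow> real \<Rightarrow> real"
    and n :: nat
    and \<alpha> \<theta> :: real
    and \<beta> \<eta> :: "nat \<Rightarrow> real"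
  assumes "n \<ge> 1"
    and "continuous_on ({0..1} \<times> {0..}) (\<lambda>(t, u). f t u)"
    and "\<And>t u. t \<in> {0..1} \<Longrightarrow> u \<ge> 0 \<Longrightarrow> f t u \<ge> 0"
    and "\<alpha> \<ge> 0"
    and "\<And>i. i \<in> {1..n} \<Longrightarrow> \<beta> i \<ge> 0"
    and "0 < \<eta> 1" and "strict_mono_on {1..n} \<eta>" and "\<eta> n < 1"
    and "\<alpha> + (\<Sum>i=1..n. \<beta> i) < 1"
    and "0 < \<theta>" and "\<theta> < 1/2"
    and "(((\<lambda>u. ereal (ratio_min f u)) \<longlongrightarrow> \<infinity>) (at_right 0) \<and>
          ((\<lambda>u. ereal (ratio_max f u)) \<longlongrightarrow> 0) at_top) \<or>
         (((\<lambda>u. ereal (ratio_max f u)) \<longlongrightarrow> 0) (at_right 0) \<and>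
          ((\<lambda>u. ereal (ratio_min f u)) \<longlongrightarrow> \<infinity>) at_top)"
  shows "\<exists>u\<in>cone_K \<theta>. positive_bvp_solution f \<alpha> n \<beta> \<eta> u"
proof -
  have "\<eta> 1 \<le> \<eta> i \<and> \<eta> i \<le> \<eta> n" if "i \<in> {1..n}" for i
    using strict_mono_on_leD[OF assms(7)] that assms(1) by auto
  then have "\<eta> i \<in> {0..1}" if "i \<in> {1..n}" for i
    using that assms(6,8) by fastforce
  then interpret nonlocal_condition \<alpha> n \<beta> \<eta>
    using assms(4,5,9) by unfold_locales
  have "\<exists>u \<rho>. 0 < \<rho> \<and> continuous_on {0..1} u \<and>
     (\<forall>t\<in>{0..1}. \<rho> * t ^ 3 \<le> u t \<and> u t \<le> \<rho> \<and> u t = solve (\<lambda>s. f s (u s)) t)"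
    using assms(12) sublinear_fixed_point[OF assms(2,3)] superlinear_fixed_point[OF assms(2,3)] by blast
  then obtain u \<rho> where "0 < \<rho>" "continuous_on {0..1} u"
    "\<And>t. t \<in> {0..1} \<Longrightarrow> \<rho> * t ^ 3 \<le> u t \<and> u t \<le> \<rho>"
    "\<And>t. t \<in> {0..1} \<Longrightarrow> u t = solve (\<lambda>s. f s (u s)) t" by blast
  from fixed_point_solves[OF assms(2,3) this assms(10,11)] show ?thesis by blast
qed

end
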